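(* Consider the projected stochastic subgradient method with soft separation and iteration-dependent temperature described in the context. Let $F(x):=f(x)+\max_{i\in\mathcal I}Q(x,\xi^{(i)})$ and $F^\star:=\min_{x\in\mathcal X}F(x)$. Suppose that, with respect to any fixed operator norm (e.g. $\|\cdot\|_{\infty\to\infty}$), $\sup_{x\in\mathcal X}\|(\mathrm{Id}-P_x+\mathbf 1p_x^\top)^{-1}\|\le C_*$ for a constant $0<C_*<\infty$. Define $I^\star(x):=\operatorname{argmax}_{i\in\mathcal I}Q(x,\xi^{(i)})$ and $$\widetilde\Delta_n:=\max_{i\in\mathcal I}Q(x_n,\xi^{(i)})-\max_{j\notin I^\star(x_n)}Q(x_n,\xi^{(j)}),$$ and suppose that there exists a $\Delta_\star>0$ such that $\Delta_\star\le\widetilde\Delta_n$ for all sufficiently large $n$. Use step sizes $\alpha_n\propto n^{-1/2}$ and, at iteration $n\ge0$, the temperature parameter $$w_n=\frac{2\Delta_\star}{\log\big((n+2)|\mathcal I|^2\big)}.$$ Then the linear average $\bar x_n:=\big(\sum_{k=1}^nkx_k\big)/\big(\sum_{k=1}^nk\big)$ satisfies $$0\le\mathbb E[F(\bar x_n)]-F^\star\le O\!\left(\frac{1+C_*^2\log(n|\mathcal I|)}{\sqrt n}\right).$$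
   Context: Problem. $\mathcal X\subseteq\mathbb R^{d_x}$ is compact and convex with $\|x-x'\|_1\le D$ for all $x,x'\in\mathcal X$. The function $f$ is convex and $L_f$-Lipschitz on an open neighborhood of $\mathcal X$. $\mathcal I$ is a finite index set and $\Xi=\{\xi^{(i)}:i\in\mathcal I\}\subset\mathbb R^{d_\xi}$. For matrices $G,E,U$ and vectors $b,h$, $Q(x,\xi):=\min_y\{b^\top y:\ Gy+Ex+U\xi-h\ge0\}$, assumed finite for every $(x,\xi)\in\mathcal X\times\Xi$. By LP duality $Q(x,\xi^{(i)})=\max\{\pi^\top(h-Ex-U\xi^{(i)}):\pi\ge0,\ G^\top\pi=b\}$; $\pi^\star(x,i)$ denotes a maximizer, chosen to minimize $\|E^\top\pi\|_1$ in case of alternative optimal solutions. $g_f(x)\in\partial f(x)$ is a bounded measurable subgradient selection, and $Z_x(i):=g_f(x)-E^\top\pi^\star(x,i)$. Kernel. For a temperature $w>0$, $p_x(i):=\exp(Q(x,\xi^{(i)})/w)/\sum_{j\in\mathcal I}\exp(Q(x,\xi^{(j)})/w)$. $q(\cdot\mid\cdot)>0$ is a fixed proposal kernel on $\mathcal I$ (with $\sum_jq(j\mid i)=1$). With $r_x(i,j):=\frac{p_x(j)q(i\mid j)}{p_x(i)q(j\mid i)}$, the acceptance probability is either Metropolis–Hastings, $A_x(i,j)=\min\{1,r_x(i,j)\}$, or Barker, $A_x(i,j)=r_x(i,j)/(1+r_x(i,j))$. The transition matrix is $P_x(i,j)=q(j\mid i)A_x(i,j)$ for $j\ne i$ and $P_x(i,i)=1-\sum_{k\ne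 i}q(k\mid i)A_x(i,k)$. Thus $p_x$ and $P_x$ depend on the temperature $w$, which is suppressed in the notation; at iteration $n$ of the method the temperature in use is $w=w_n$. Method. Start from $x_0\in\mathcal X$ and $I_0$ uniform on $\mathcal I$. For $n=0,1,2,\dots$: conditionally on the past, draw $I_{n+1}\sim P_{x_n}(I_n,\cdot)$ (with temperature $w_n$) and set $x_{n+1}=\Pi_{\mathcal X}\big(x_n-\alpha_{n+1}Z_{x_n}(I_{n+1})\big)$, with $\Pi_{\mathcal X}$ the Euclidean projection onto $\mathcal X$. *)

theory Defs
  imports "HOL-Probability.Probability"
begin

section \<open>Convex objective\<close>

definition norm1 :: "real ^ 'n \<Rightarrow> real" where
  "norm1 v = (\<Sum>k\<in>UNIV. \<bar>v $ k\<bar>)"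

text \<open>Here S is the open neighbourhood on which the convex function f is considered.\<close>

definition subdifferential :: "(real ^ 'n) set \<Rightarrow> (real ^ 'n \<Rightarrow> real) \<Rightarrow> real ^ 'n \<Rightarrow> (real ^ 'n) set" where
  "subdifferential S f x = {g. \<forall>y\<in>S. f y \<ge> f x + g \<bullet> (y - x)}"

section \<open>Recourse problem\<close>

definition recourse_feasible ::
  "real ^ 'y ^ 'm \<Rightarrow> real ^ 'x ^ 'm \<Rightarrow> real ^ 'u ^ 'm \<Rightarrow> real ^ 'm \<Rightarrow> real ^ 'x \<Rightarrow> real ^ 'u \<Rightarrow> (real ^ 'y) set" where
  "recourse_feasible G E U h x \<xi> = {y. \<forall>k. (G *v y + E *v x + U *v \<xi> - h) $ k \<ge> 0}"

definition recourse_value ::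
  "real ^ 'y ^ 'm \<Rightarrow> real ^ 'x ^ 'm \<Rightarrow> real ^ 'u ^ 'm \<Rightarrow> real ^ 'y \<Rightarrow> real ^ 'm \<Rightarrow> real ^ 'x \<Rightarrow> real ^ 'u \<Rightarrow> real" where
  "recourse_value G E U b h x \<xi> = (INF y\<in>recourse_feasible G E U h x \<xi>. b \<bullet> y)"

text \<open>Feasible and bounded below; for a linear program the infimum is then attained.\<close>

definition recourse_finite ::
  "real ^ 'y ^ 'm \<Rightarrow> real ^ 'x ^ 'm \<Rightarrow> real ^ 'u ^ 'm \<Rightarrow> real ^ 'y \<Rightarrow> real ^ 'm \<Rightarrow> real ^ 'x \<Rightarrow> real ^ 'u \<Rightarrow> bool" where
  "recourse_finite G E U b h x \<xi> \<longleftrightarrow>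
     recourse_feasible G E U h x \<xi> \<noteq> {} \<and> bdd_below ((\<bullet>) b ` recourse_feasible G E U h x \<xi>)"

definition dual_feasible :: "real ^ 'y ^ 'm \<Rightarrow> real ^ 'y \<Rightarrow> (real ^ 'm) set" where
  "dual_feasible G b = {\<pi>. (\<forall>k. \<pi> $ k \<ge> 0) \<and> transpose G *v \<pi> = b}"

definition dual_solutions ::
  "real ^ 'y ^ 'm \<Rightarrow> real ^ 'x ^ 'm \<Rightarrow> real ^ 'u ^ 'm \<Rightarrow> real ^ 'y \<Rightarrow> real ^ 'm \<Rightarrow> real ^ 'x \<Rightarrow> real ^ 'u \<Rightarrow> (real ^ 'm) set" where
  "dual_solutions G E U b h x \<xi> =
     {\<pi>. is_arg_max (\<lambda>\<pi>. \<pi> \<bullet> (h - E *v x - U *v \<xi>)) (\<lambda>\<pi>. \<pi> \<in> dual_feasible G b) \<pi>}"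

section \<open>Soft separation kernel\<close>

text \<open>The scenario values Q(x, .) at a fixed point x enter as a score function s on I.\<close>

definition gibbs :: "'i set \<Rightarrow> real \<Rightarrow> ('i \<Rightarrow> real) \<Rightarrow> 'i \<Rightarrow> real" where
  "gibbs I w s i = exp (s i / w) / (\<Sum>j\<in>I. exp (s j / w))"

datatype acceptance_rule = Metropolis_Hastings | Barker

fun accept :: "acceptance_rule \<Rightarrow> real \<Rightarrow> real" where
  "accept Metropolis_Hastings r = min 1 r"
| "accept Barker r = r / (1 + r)"

text \<open>A proposal kernel is written q j i for the probability of proposing j from i.\<close>

definition accept_prob ::
  "acceptance_rule \<Rightarrow> 'i set \<Rightarrow> ('i \<Rightarrow> 'i \<Rightarrow> real) \<Rightarrow> real \<Rightarrow> ('i \<Rightarrow> real) \<Rightarrow> 'i \<Rightarrow> 'i \<Rightarrow> real" where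
  "accept_prob rule I q w s i j =
     accept rule ((gibbs I w s j * q i j) / (gibbs I w s i * q j i))"

definition transition ::
  "acceptance_rule \<Rightarrow> 'i set \<Rightarrow> ('i \<Rightarrow> 'i \<Rightarrow> real) \<Rightarrow> real \<Rightarrow> ('i \<Rightarrow> real) \<Rightarrow> 'i \<Rightarrow> 'i \<Rightarrow> real" where
  "transition rule I q w s i j =
     (if j \<noteq> i then q j i * accept_prob rule I q w s i j
      else 1 - (\<Sum>k\<in>I - {i}. q k i * accept_prob rule I q w s i k))"

text \<open>The gap is extended-real valued: if every index is a maximizer, the inner supremum is
  over the empty set, hence minus infinity, and the gap is infinite.\<close>

definition argmax_set :: "'i set \<Rightarrow> ('i \<Rightarrow> real) \<Rightarrow> 'i set" where
  "argmax_set I s = {i. is_arg_max s (\<lambda>i. i \<in> I) i}"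

definition gap :: "'i set \<Rightarrow> ('i \<Rightarrow> real) \<Rightarrow> ereal" where
  "gap I s = ereal (MAX i\<in>I. s i) - (SUP j\<in>I - argmax_set I s. ereal (s j))"

section \<open>Matrices and norms indexed by a finite set\<close>

text \<open>Matrices indexed by a finite set I are functions of which only the entries in I matter.
  A norm on the space of real vectors indexed by I is represented by a seminorm on all functions
  that vanishes exactly on the functions vanishing on I; it depends only on the values on I.\<close>

definition inverse_on :: "'i set \<Rightarrow> ('i \<Rightarrow> 'i \<Rightarrow> real) \<Rightarrow> 'i \<Rightarrow> 'i \<Rightarrow> real" where
  "inverse_on I A = (SOME B. \<forall>i\<in>I. \<forall>j\<in>I.
     (\<Sum>k\<in>I. A i k * B k j) = of_bool (i = j) \<and> (\<Sum>k\<in>I. B i k * A k j) = of_bool (i = j))"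

definition norm_on :: "'i set \<Rightarrow> (('i \<Rightarrow> real) \<Rightarrow> real) \<Rightarrow> bool" where
  "norm_on I N \<longleftrightarrow>
     (\<forall>v. 0 \<le> N v) \<and> (\<forall>v. N v = 0 \<longleftrightarrow> (\<forall>i\<in>I. v i = 0)) \<and>
     (\<forall>a v. N (\<lambda>i. a * v i) = \<bar>a\<bar> * N v) \<and>
     (\<forall>u v. N (\<lambda>i. u i + v i) \<le> N u + N v)"

text \<open>Every norm satisfies the following for some kappa; for the maximum norm kappa = 1 works.\<close>

definition max_norm_equivalent :: "real \<Rightarrow> 'i set \<Rightarrow> (('i \<Rightarrow> real) \<Rightarrow> real) \<Rightarrow> bool" where
  "max_norm_equivalent \<kappa> I N \<longleftrightarrow>
     (\<exists>a>0. \<forall>v. a * (MAX i\<in>I. \<bar>v i\<bar>) \<le> N v \<and> N v \<le> \<kappa> * a * (MAX i\<in>I. \<bar>v i\<bar>))"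

definition operator_norm :: "'i set \<Rightarrow> (('i \<Rightarrow> real) \<Rightarrow> real) \<Rightarrow> ('i \<Rightarrow> 'i \<Rightarrow> real) \<Rightarrow> real" where
  "operator_norm I N A = (SUP v\<in>{v. N v \<le> 1}. N (\<lambda>i. \<Sum>j\<in>I. A i j * v j))"

text \<open>The inverse of Id - P + 1 p', where 1 p' is the matrix all of whose rows are p.\<close>

definition fundamental_matrix ::
  "acceptance_rule \<Rightarrow> 'i set \<Rightarrow> ('i \<Rightarrow> 'i \<Rightarrow> real) \<Rightarrow> real \<Rightarrow> ('i \<Rightarrow> real) \<Rightarrow> 'i \<Rightarrow> 'i \<Rightarrow> real" where
  "fundamental_matrix rule I q w s =
     inverse_on I (\<lambda>i j. of_bool (i = j) - transition rule I q w s i j + gibbs I w s j)"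

section \<open>The method\<close>

text \<open>Since the starting point is deterministic, the n-th iterate is a function of the indices
  drawn up to time n; js is the index path.\<close>

primrec iterate ::
  "(real ^ 'x) set \<Rightarrow> (nat \<Rightarrow> real) \<Rightarrow> (real ^ 'x \<Rightarrow> 'i \<Rightarrow> real ^ 'x) \<Rightarrow> real ^ 'x
     \<Rightarrow> (nat \<Rightarrow> 'i) \<Rightarrow> nat \<Rightarrow> real ^ 'x" where
  "iterate X \<alpha> Z x0 js 0 = x0"
| "iterate X \<alpha> Z x0 js (Suc n) =
     closest_point X (iterate X \<alpha> Z x0 js n - \<alpha> (Suc n) *\<^sub>R Z (iterate X \<alpha> Z x0 js n) (js (Suc n)))"

text \<open>An index process on I, started uniformly, whose (n+1)-st state is drawn, given the past js up
  to time n, from row js n of the transition matrix P n js, which may itself depend on that past.\<close>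

definition adaptive_chain ::
  "'w measure \<Rightarrow> 'i set \<Rightarrow> (nat \<Rightarrow> 'w \<Rightarrow> 'i) \<Rightarrow> (nat \<Rightarrow> (nat \<Rightarrow> 'i) \<Rightarrow> 'i \<Rightarrow> 'i \<Rightarrow> real) \<Rightarrow> bool" where
  "adaptive_chain M I J P \<longleftrightarrow>
     prob_space M \<and>
     (\<forall>n. J n \<in> measurable M (count_space I)) \<and>
     (\<forall>i\<in>I. \<P>(\<omega> in M. J 0 \<omega> = i) = 1 / real (card I)) \<and>
     (\<forall>n js. \<P>(\<omega> in M. \<forall>k\<le>n. J k \<omega> = js k) > 0 \<longrightarrow>
        (\<forall>j\<in>I. \<P>(\<omega> in M. J (Suc n) \<omega> = j \<bar> \<forall>k\<le>n. J k \<omega> = js k) = P n js (js n) j))"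

definition linear_average :: "(nat \<Rightarrow> real ^ 'x) \<Rightarrow> nat \<Rightarrow> real ^ 'x" where
  "linear_average x n = (1 / (\<Sum>k=1..n. real k)) *\<^sub>R (\<Sum>k=1..n. real k *\<^sub>R x k)"

end

(*
  Linear programming duality makes each Z_x(i) a subgradient of f + Q(., xi(i)), and since the dual
  solution of minimal norm is dominated by one of finitely many vertices, all Z_x(i) are bounded by a
  constant not depending on the scenarios. Let y be a minimizer and let phi_x(i) be the slack
  max Q(x, .) - Q(x, xi(i)). Then
    <Z_x(i), x - y> >= F(x) - F(y) - psi_x(i),   psi_x = phi_x - phi_y,
  so the usual distance recursion reduces the claim to the weighted sum of E psi_{x_n}(I_{n+1}).
  In contrast to Z_x, the function psi_x is Lipschitz in x, and in contrast to phi_x it is bounded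
  independently of the scenarios. Solving the Poisson equation (Id - P + 1 p') nu = psi splits psi into
  its Gibbs mean, which by the gap and the choice of w_n is O(1/sqrt n), a martingale difference,
  a telescoping term, and a drift term. The drift is at most C^2 times the change of Q(x_n, .)/w_n,
  that is O(C^2 log(n |I|)/sqrt n). Every other contribution is O(1/sqrt n) with a constant that may
  depend on the instance; as C >= 1, the logarithmic term eventually absorbs it.
*)
theory Submission
  imports Defs
begin

section \<open>Duality for the recourse problem\<close>

text \<open>The shape is dictated by the order of quantifiers: the constant is fixed before the
  scenario set, the proposal, the norm and \<open>C\<close>. Hence only the diameter, the step size,
  \<open>\<kappa>\<close>, the gap and the bounds on subgradients may multiply the logarithm, while
  the size of the scenario values and the time from which the gap holds may only shift the index
  from which the rate is claimed. The logarithm arises because the kernel sees scores only after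
  division by the temperature: a move of the iterate by O(1/sqrt n) changes the exponents by 1/w_n
  times as much. The change of temperature itself contributes O(1/n) only, and so may carry the size
  of the scenario values. The square of \<open>C\<close> arises because one factor bounds a Poisson
  solution and a second one is paid for comparing the solutions of two neighbouring kernels. No
  power of |I| enters: kernels are compared by row sums, Gibbs laws by ratios, and the factor |I|^2
  in the temperature cancels the number of terms in the Gibbs mean.\<close>

lemma convex_cone_nonneg_combinations:
  fixes a :: "'m::finite \<Rightarrow> 'v::real_vector"
  shows "convex_cone hull (range a) = {\<Sum>k\<in>UNIV. \<pi> k *\<^sub>R a k |\<pi>. \<forall>k. 0 \<le> \<pi> k}" (is "_ = ?K")
proof (rule hull_unique)
  show "range a \<subseteq> ?K"
  proof clarify
    fix k
    show "\<exists>\<pi>. a k = (\<Sum>k\<in>UNIV. \<pi> k *\<^sub>R a k) \<and> (\<forall>k. 0 \<le> \<pi> k)"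
      by (rule exI[of _ "\<lambda>l. of_bool (l = k)"]) (simp add: of_bool_def if_distrib[of "\<lambda>t. t *\<^sub>R _"] cong: if_cong)
  qed
  have "(\<Sum>k\<in>UNIV. \<pi> k *\<^sub>R a k) + (\<Sum>k\<in>UNIV. \<rho> k *\<^sub>R a k) \<in> ?K"
    if "\<forall>k. 0 \<le> \<pi> k" "\<forall>k. 0 \<le> \<rho> k" for \<pi> \<rho> :: "'m \<Rightarrow> real"
    using that by (auto intro!: exI[of _ "\<lambda>k. \<pi> k + \<rho> k"] simp: scaleR_add_left sum.distrib)
  moreover have "c *\<^sub>R (\<Sum>k\<in>UNIV. \<pi> k *\<^sub>R a k) \<in> ?K" if "\<forall>k. 0 \<le> \<pi> k" "0 \<le> c" for \<pi> :: "'m \<Rightarrow> real" and c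
    using that by (auto intro!: exI[of _ "\<lambda>k. c * \<pi> k"] simp: scaleR_sum_right)
  moreover have "0 \<in> ?K" by (auto intro: exI[of _ "\<lambda>_. 0"])
  ultimately show "convex_cone ?K"
    unfolding convex_cone_iff by blast
  fix T assume T: "range a \<subseteq> T" "convex_cone T"
  have "(\<Sum>k\<in>UNIV. \<pi> k *\<^sub>R a k) \<in> T" if "\<forall>k. 0 \<le> \<pi> k" for \<pi> :: "'m \<Rightarrow> real"
  proof -
    have "(\<Sum>k\<in>A. \<pi> k *\<^sub>R a k) \<in> T" if "finite A" for A
      using that
    proof induction
      case empty
      show ?case using convex_cone_contains_0[OF T(2)] by simp
    next
      case (insert k A)
      then show ?case
        using T \<open>\<forall>k. 0 \<le> \<pi> k\<close>
        by (auto intro!: convex_cone_add convex_cone_scaleR)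
    qed
    then show ?thesis by simp
  qed
  then show "?K \<subseteq> T" by blast
qed

text \<open>A finitely generated cone is closed, so a point outside it is strictly separated from it
  by a hyperplane.\<close>

lemma farkas:
  fixes a :: "'m::finite \<Rightarrow> 'v::euclidean_space"
  assumes "\<And>y. (\<And>k. 0 \<le> y \<bullet> a k) \<Longrightarrow> 0 \<le> y \<bullet> z"
  obtains \<pi> where "\<And>k. 0 \<le> \<pi> k" "z = (\<Sum>k\<in>UNIV. \<pi> k *\<^sub>R a k)"
proof -
  let ?K = "convex_cone hull (range a)"
  have "z \<in> ?K"
  proof (rule ccontr)
    assume "z \<notin> ?K"
    then obtain y t where y: "y \<bullet> z < t" "\<And>x. x \<in> ?K \<Longrightarrow> t < y \<bullet> x"
      using separating_hyperplane_closed_point[OF convex_convex_cone_hull closed_convex_cone_hull, of "range a" z]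
      by auto
    have "t < 0" using y(2)[OF convex_cone_hull_contains_0] by simp
    have "0 \<le> y \<bullet> a k" for k
    proof (rule ccontr)
      assume neg: "\<not> 0 \<le> y \<bullet> a k"
      \<comment> \<open>This multiple of the generator has \<open>y\<close>-value exactly
        \<open>t\<close>, while the whole cone lies strictly above \<open>t\<close>.\<close>
      have "(t / (y \<bullet> a k)) *\<^sub>R a k \<in> ?K"
        using neg \<open>t < 0\<close> by (intro convex_cone_hull_mul hull_inc) (auto simp: divide_nonpos_nonpos)
      from y(2)[OF this] neg show False by simp
    qed
    from assms[OF this] y(1) \<open>t < 0\<close> show False by simp
  qed
  then show thesis
    using that unfolding convex_cone_nonneg_combinations by auto
qed


lemma recourse_weak_duality:
  fixes G :: "real ^ 'y ^ 'm" and E :: "real ^ 'x ^ 'm" and U :: "real ^ 'u ^ 'm"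
  assumes fin: "recourse_finite G E U b h x \<xi>" and \<pi>: "\<pi> \<in> dual_feasible G b"
  shows "\<pi> \<bullet> (h - E *v x - U *v \<xi>) \<le> recourse_value G E U b h x \<xi>"
  unfolding recourse_value_def
proof (rule cINF_greatest)
  show "recourse_feasible G E U h x \<xi> \<noteq> {}"
    using fin by (simp add: recourse_finite_def)
  fix y assume y: "y \<in> recourse_feasible G E U h x \<xi>"
  have "\<pi> \<bullet> (h - E *v x - U *v \<xi>) \<le> \<pi> \<bullet> (G *v y)"
    unfolding inner_vec_def inner_real_def
  proof (intro sum_mono mult_left_mono)
    fix k
    show "(h - E *v x - U *v \<xi>) $ k \<le> (G *v y) $ k"
      using y by (simp add: recourse_feasible_def algebra_simps)
    show "0 \<le> \<pi> $ k" using \<pi> by (simp add: dual_feasible_def)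
  qed
  also have "\<dots> = b \<bullet> y"
    using \<pi> by (auto simp: dual_feasible_def dot_lmul_matrix)
  finally show "\<pi> \<bullet> (h - E *v x - U *v \<xi>) \<le> b \<bullet> y" .
qed

text \<open>Farkas' lemma is applied to the constraint columns extended by the right-hand side, and to
  the column (0, -1), which relaxes the dual objective value from an equation to an inequality.\<close>

lemma recourse_strong_duality:
  fixes G :: "real ^ 'y ^ 'm" and E :: "real ^ 'x ^ 'm" and U :: "real ^ 'u ^ 'm"
  assumes fin: "recourse_finite G E U b h x \<xi>"
    and sol: "\<pi> \<in> dual_solutions G E U b h x \<xi>"
  shows "recourse_value G E U b h x \<xi> = \<pi> \<bullet> (h - E *v x - U *v \<xi>)"
proof -
  let ?r = "h - E *v x - U *v \<xi>" and ?P = "recourse_feasible G E U h x \<xi>"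
  let ?Q = "recourse_value G E U b h x \<xi>"
  have P: "y \<in> ?P \<longleftrightarrow> (\<forall>k. ?r $ k \<le> (G *v y) $ k)" for y
    by (auto simp: recourse_feasible_def algebra_simps)
  have bdd: "bdd_below ((\<bullet>) b ` ?P)" and ne: "?P \<noteq> {}"
    using fin by (auto simp: recourse_finite_def)
  have Q: "?Q \<le> b \<bullet> y" if "y \<in> ?P" for y
    unfolding recourse_value_def by (rule cINF_lower[OF bdd that])
  obtain y0 where y0: "y0 \<in> ?P" using ne by blast
  define a :: "'m option \<Rightarrow> (real^'y) \<times> real"
    where "a k = (case k of None \<Rightarrow> (0, -1) | Some k \<Rightarrow> (row k G, ?r $ k))" for k
  have "0 \<le> yt \<bullet> (b, ?Q)" if yt: "\<And>k. 0 \<le> yt \<bullet> a k" for yt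
  proof -
    obtain y t where [simp]: "yt = (y, t)" by (cases yt)
    have t: "t \<le> 0" using yt[of None] by (simp add: a_def)
    have y: "0 \<le> (G *v y) $ k + t * ?r $ k" for k
      using yt[of "Some k"] by (simp add: a_def matrix_vector_mul_component inner_commute row_def)
    \<comment> \<open>The coordinate \<open>t\<close> homogenizes the primal: for
      \<open>t = 0\<close> the vector \<open>y\<close> is a recession direction of the feasible set,
      for \<open>t < 0\<close> the point \<open>y\<close> divided by \<open>- t\<close> is
      feasible.\<close>
    show ?thesis
    proof (cases "t = 0")
      case True
      have "0 \<le> b \<bullet> y"
      proof (rule ccontr)
        assume neg: "\<not> 0 \<le> b \<bullet> y"
        \<comment> \<open>The length at which the ray from \<open>y0\<close> would reach the value
          \<open>?Q - 1\<close>, below the infimum.\<close>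
        define l where "l = (b \<bullet> y0 - ?Q + 1) / - (b \<bullet> y)"
        have "0 \<le> l" using neg Q[OF y0] unfolding l_def by (intro divide_nonneg_pos) auto
        then have "?r $ k \<le> (G *v (y0 + l *\<^sub>R y)) $ k" for k
          using y[of k] y0 True unfolding P
          by (simp add: matrix_vector_right_distrib matrix_vector_mult_scaleR add_increasing2)
        then have "?Q \<le> b \<bullet> (y0 + l *\<^sub>R y)"
          using Q P by blast
        moreover have "l * (b \<bullet> y) = - (b \<bullet> y0 - ?Q + 1)"
          using neg by (simp add: l_def)
        ultimately show False by (simp add: inner_add_right)
      qed
      then show ?thesis using True by (simp add: inner_commute)
    next
      case False
      with t have t: "t < 0" by simp
      define s where "s = - inverse t"
      have s: "0 < s" "s * t = - 1" using t by (simp_all add: s_def)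
      have "?r $ k \<le> (G *v (s *\<^sub>R y)) $ k" for k
      proof -
        have "0 \<le> s * ((G *v y) $ k + t * ?r $ k)"
          using y[of k] s(1) by simp
        also have "\<dots> = s * (G *v y) $ k + (s * t) * ?r $ k"
          by (simp only: distrib_left mult.assoc)
        finally show ?thesis by (simp add: s(2) matrix_vector_mult_scaleR)
      qed
      then have "?Q \<le> b \<bullet> (s *\<^sub>R y)"
        using Q P by blast
      then have "(- t) * ?Q \<le> (- t) * (s * (b \<bullet> y))"
        using t by (intro mult_left_mono) auto
      also have "\<dots> = - (s * t) * (b \<bullet> y)" by simp
      finally show ?thesis by (simp add: s(2) inner_commute)
    qed
  qed
  from farkas[of a, OF this] obtain \<rho> where \<rho>: "\<And>k. 0 \<le> \<rho> k"
    and z: "(b, ?Q) = (\<Sum>k\<in>UNIV. \<rho> k *\<^sub>R a k)" by blast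
  define \<sigma> :: "real^'m" where "\<sigma> = (\<chi> k. \<rho> (Some k))"
  have z': "(b, ?Q) = \<rho> None *\<^sub>R a None + (\<Sum>k\<in>UNIV. \<rho> (Some k) *\<^sub>R a (Some k))"
    unfolding z by (simp add: UNIV_option_conv sum.reindex)
  have "b = (\<Sum>k\<in>UNIV. \<rho> (Some k) *\<^sub>R row k G)"
    using arg_cong[OF z', of fst] by (simp add: a_def fst_sum)
  also have "\<dots> = transpose G *v \<sigma>"
    by (simp add: vec_eq_iff matrix_vector_mult_def transpose_def row_def \<sigma>_def mult.commute)
  finally have "\<sigma> \<in> dual_feasible G b"
    using \<rho> by (simp add: dual_feasible_def \<sigma>_def)
  then have "\<sigma> \<bullet> ?r \<le> \<pi> \<bullet> ?r"
    using sol by (auto simp: dual_solutions_def is_arg_max_linorder)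
  moreover have "?Q \<le> \<sigma> \<bullet> ?r"
    using arg_cong[OF z', of snd] \<rho>[of None] by (simp add: a_def snd_sum \<sigma>_def inner_vec_def)
  moreover have "\<pi> \<bullet> ?r \<le> ?Q"
    using recourse_weak_duality[OF fin] sol by (auto simp: dual_solutions_def is_arg_max_def)
  ultimately show ?thesis by simp
qed

text \<open>The extreme points of the dual polyhedron, encoded as the feasible points that are
  determined by their zero set; finiteness is then immediate. They depend on \<open>G\<close> and
  \<open>b\<close> only, hence are common to all \<open>x\<close> and all scenarios.\<close>

definition vertex_duals :: "real ^ 'y ^ 'm \<Rightarrow> real ^ 'y \<Rightarrow> (real ^ 'm) set" where
  "vertex_duals G b = {\<pi> \<in> dual_feasible G b.
     \<forall>\<rho>\<in>dual_feasible G b. (\<forall>k. \<pi> $ k = 0 \<longrightarrow> \<rho> $ k = 0) \<longrightarrow> \<rho> = \<pi>}"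

lemma finite_vertex_duals: "finite (vertex_duals G b)"
proof (rule finite_imageD)
  show "finite ((\<lambda>\<pi>. {k. \<pi> $ k = 0}) ` vertex_duals G b)" by simp
  show "inj_on (\<lambda>\<pi>. {k. \<pi> $ k = 0}) (vertex_duals G b)"
    by (auto simp: inj_on_def vertex_duals_def)
qed

text \<open>A dual solution of minimal support is a vertex: otherwise one could move along a
  direction supported there, without changing the objective, until a coordinate vanishes.\<close>

lemma dual_solution_vertex:
  fixes G :: "real ^ 'y ^ 'm" and E :: "real ^ 'x ^ 'm" and U :: "real ^ 'u ^ 'm"
  assumes "\<pi>0 \<in> dual_solutions G E U b h x \<xi>"
  obtains \<pi> where "\<pi> \<in> dual_solutions G E U b h x \<xi>" "\<pi> \<in> vertex_duals G b"
proof -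
  let ?r = "h - E *v x - U *v \<xi>" and ?S = "dual_solutions G E U b h x \<xi>"
  let ?F = "dual_feasible G b"
  have S: "\<pi> \<in> ?S \<longleftrightarrow> \<pi> \<in> ?F \<and> (\<forall>\<rho>\<in>?F. \<rho> \<bullet> ?r \<le> \<pi> \<bullet> ?r)" for \<pi>
    by (auto simp: dual_solutions_def is_arg_max_linorder)
  define supp where "supp \<pi> = {k. \<pi> $ k \<noteq> 0}" for \<pi> :: "real^'m"
  obtain \<pi> where \<pi>: "\<pi> \<in> ?S" and min: "\<And>\<rho>. \<rho> \<in> ?S \<Longrightarrow> card (supp \<pi>) \<le> card (supp \<rho>)"
    using ex_has_least_nat[of "\<lambda>\<pi>. \<pi> \<in> ?S" \<pi>0 "\<lambda>\<pi>. card (supp \<pi>)"] assms by blast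
  have \<pi>F: "\<pi> \<in> ?F" using \<pi> S by blast
  have no_ray: "\<forall>k. 0 \<le> d $ k"
    if d: "transpose G *v d = 0" "\<And>k. \<pi> $ k = 0 \<Longrightarrow> d $ k = 0" "0 \<le> d \<bullet> ?r" for d
  proof (rule ccontr)
    let ?T = "(\<lambda>k. \<pi> $ k / - (d $ k)) ` {k. d $ k < 0}"
    assume "\<not> ?thesis"
    then have ne: "?T \<noteq> {}" by (auto simp: not_le)
    \<comment> \<open>Ratio test: the largest step that keeps every coordinate nonnegative. It sends
      coordinate \<open>l\<close> to zero, and \<open>d\<close> vanishes off the support of
      \<open>\<pi>\<close>, so the support strictly shrinks.\<close>
    define t where "t = Min ?T"
    have "t \<in> ?T" unfolding t_def using ne by (intro Min_in) auto
    then obtain l where l: "d $ l < 0" "t = \<pi> $ l / - (d $ l)" by blast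
    have t: "t \<le> \<pi> $ k / - (d $ k)" if "d $ k < 0" for k
      unfolding t_def using that by (intro Min_le) auto
    have \<pi>0: "0 \<le> \<pi> $ k" for k using \<pi>F by (simp add: dual_feasible_def)
    have t0: "0 \<le> t" using l \<pi>0[of l] by (simp add: divide_nonneg_pos del: divide_minus_right)
    let ?\<rho> = "\<pi> + t *\<^sub>R d"
    have "0 \<le> \<pi> $ k + t * d $ k" for k
    proof (cases "d $ k < 0")
      case True
      then show ?thesis using t[OF True] by (simp add: field_simps)
    next
      case False
      then show ?thesis using t0 \<pi>0[of k] by simp
    qed
    then have \<rho>F: "?\<rho> \<in> ?F"
      using \<pi>F d(1)
      by (simp add: dual_feasible_def matrix_vector_right_distrib matrix_vector_mult_scaleR
          del: transpose_matrix_vector)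
    moreover have "\<pi> \<bullet> ?r \<le> ?\<rho> \<bullet> ?r"
      using d(3) t0 by (simp add: inner_add_left)
    ultimately have "?\<rho> \<in> ?S"
      using \<pi> unfolding S by (meson order_trans)
    moreover have "supp ?\<rho> \<subset> supp \<pi>"
    proof
      show "supp ?\<rho> \<subseteq> supp \<pi>" using d(2) by (auto simp: supp_def)
      have "l \<in> supp \<pi>" using d(2) l(1) by (auto simp: supp_def)
      moreover have "l \<notin> supp ?\<rho>" using l by (simp add: supp_def)
      ultimately show "supp ?\<rho> \<noteq> supp \<pi>" by blast
    qed
    then have "card (supp ?\<rho>) < card (supp \<pi>)"
      by (intro psubset_card_mono) auto
    ultimately show False using min by fastforce
  qed
  have "\<rho> = \<pi>" if \<rho>: "\<rho> \<in> ?F" "\<forall>k. \<pi> $ k = 0 \<longrightarrow> \<rho> $ k = 0" for \<rho>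
  proof -
    define d where "d = \<pi> - \<rho>"
    have kernel: "transpose G *v d = 0" "transpose G *v (- d) = 0"
      using \<rho>(1) \<pi>F by (simp_all add: d_def dual_feasible_def matrix_vector_mult_diff_distrib)
    have supp: "d $ k = 0" if "\<pi> $ k = 0" for k
      using \<rho>(2) that by (simp add: d_def)
    have "0 \<le> d \<bullet> ?r"
      using \<pi> \<rho>(1) by (simp add: S d_def inner_diff_left)
    from no_ray[OF kernel(1) supp this] have nonneg: "\<forall>k. 0 \<le> d $ k" .
    \<comment> \<open>As \<open>d\<close> is now known to be nonnegative, \<open>\<pi> + d\<close>
      is feasible too; optimality of \<open>\<pi>\<close> then gives
      \<open>d \<bullet> ?r \<le> 0\<close>, which permits \<open>no_ray\<close> for
      \<open>- d\<close>.\<close>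
    have "\<pi> + d \<in> ?F"
      using \<pi>F nonneg kernel(1) by (simp add: dual_feasible_def matrix_vector_right_distrib del: transpose_matrix_vector)
    then have "(\<pi> + d) \<bullet> ?r \<le> \<pi> \<bullet> ?r"
      using \<pi> S by blast
    then have "\<forall>k. 0 \<le> (- d) $ k"
      by (intro no_ray[OF kernel(2)]) (simp_all add: supp inner_add_left)
    with nonneg have "d = 0"
      by (simp add: vec_eq_iff) (meson antisym)
    then show ?thesis by (simp add: d_def)
  qed
  then have "\<pi> \<in> vertex_duals G b"
    using \<pi>F by (simp add: vertex_duals_def)
  with \<pi> that show thesis by blast
qed


text \<open>\<open>B\<close> can be fixed before \<open>U\<close>, \<open>h\<close>,
  \<open>x\<close> and the scenario because \<open>G\<close> and \<open>b\<close> alone determine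
  the vertices. The tie-breaking rule is what excludes arbitrarily long solutions on an unbounded
  optimal face.\<close>

lemma optimal_dual_norm1_bound:
  fixes G :: "real ^ 'y ^ 'm" and E :: "real ^ 'x ^ 'm"
  obtains B where "0 \<le> B"
    "\<And>(U :: real ^ 'u ^ 'm) h x \<xi> \<pi>. is_arg_min (\<lambda>\<pi>. norm1 (transpose E *v \<pi>))
        (\<lambda>\<pi>. \<pi> \<in> dual_solutions G E U b h x \<xi>) \<pi> \<Longrightarrow> norm (transpose E *v \<pi>) \<le> B"
proof
  \<comment> \<open>The added 0 keeps the maximum defined and nonnegative if there are no
    vertices.\<close>
  let ?V = "insert 0 ((\<lambda>\<pi>. norm1 (transpose E *v \<pi>)) ` vertex_duals G b)"
  have fin: "finite ?V" using finite_vertex_duals by blast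
  show "0 \<le> Max ?V" using fin by (intro Max_ge) auto
  fix U :: "real ^ 'u ^ 'm" and h x \<xi> \<pi>
  assume \<pi>: "is_arg_min (\<lambda>\<pi>. norm1 (transpose E *v \<pi>)) (\<lambda>\<pi>. \<pi> \<in> dual_solutions G E U b h x \<xi>) \<pi>"
  then have "\<pi> \<in> dual_solutions G E U b h x \<xi>" by (simp add: is_arg_min_def)
  from dual_solution_vertex[OF this] obtain \<rho>
    where \<rho>: "\<rho> \<in> dual_solutions G E U b h x \<xi>" "\<rho> \<in> vertex_duals G b" .
  have "norm (transpose E *v \<pi>) \<le> norm1 (transpose E *v \<pi>)"
    unfolding norm1_def by (rule norm_le_l1_cart)
  also have "\<dots> \<le> norm1 (transpose E *v \<rho>)"
    using \<pi> \<rho>(1) by (simp add: is_arg_min_linorder del: transpose_matrix_vector)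
  also have "\<dots> \<le> Max ?V"
    using fin \<rho>(2) by (intro Max_ge) auto
  finally show "norm (transpose E *v \<pi>) \<le> Max ?V" .
qed

text \<open>The dual feasible set does not depend on \<open>x\<close>, so an optimal dual at
  \<open>x\<close> still gives a lower bound at \<open>y\<close>, and its objective is affine in the
  point.\<close>

lemma recourse_value_subgradient:
  fixes G :: "real ^ 'y ^ 'm" and E :: "real ^ 'x ^ 'm" and U :: "real ^ 'u ^ 'm"
  assumes "recourse_finite G E U b h x \<xi>" "recourse_finite G E U b h y \<xi>"
    and \<pi>: "\<pi> \<in> dual_solutions G E U b h x \<xi>"
  shows "recourse_value G E U b h x \<xi> - (transpose E *v \<pi>) \<bullet> (y - x) \<le> recourse_value G E U b h y \<xi>"
proof -
  have "\<pi> \<bullet> (h - E *v y - U *v \<xi>) \<le> recourse_value G E U b h y \<xi>"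
    using recourse_weak_duality[OF assms(2)] \<pi> by (auto simp: dual_solutions_def is_arg_max_def)
  moreover have "recourse_value G E U b h x \<xi> = \<pi> \<bullet> (h - E *v x - U *v \<xi>)"
    by (rule recourse_strong_duality[OF assms(1) \<pi>])
  moreover have "(transpose E *v \<pi>) \<bullet> (y - x) = \<pi> \<bullet> (E *v y) - \<pi> \<bullet> (E *v x)"
    by (simp add: dot_lmul_matrix matrix_vector_mult_diff_distrib inner_diff_right)
  ultimately show ?thesis by (simp add: inner_diff_right)
qed

section \<open>Inverses and operator norms on a finite index set\<close>

text \<open>Gaussian elimination, one column per induction step. Rows and columns have separate
  index sets because the pivot row found for a column need not carry the same index.\<close>

lemma solve_of_injective_matrix:
  fixes A :: "'r \<Rightarrow> 'c \<Rightarrow> real"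
  assumes "finite R" "finite S" "card R = card S"
    and "\<And>v. (\<And>i. i \<in> R \<Longrightarrow> (\<Sum>j\<in>S. A i j * v j) = 0) \<Longrightarrow> \<forall>j\<in>S. v j = 0"
  shows "\<exists>v. \<forall>i\<in>R. (\<Sum>j\<in>S. A i j * v j) = y i"
  using assms(2,1,3,4)
proof (induction S arbitrary: R A y rule: finite_induct)
  case empty
  then show ?case by simp
next
  case (insert a S)
  have "\<exists>i\<in>R. A i a \<noteq> 0"
  proof (rule ccontr)
    assume "\<not> ?thesis"
    then have "(\<Sum>j\<in>insert a S. A i j * of_bool (j = a)) = 0" if "i \<in> R" for i
      using that insert.hyps by (auto intro!: sum.neutral)
    from insert.prems(3)[OF this] show False by simp
  qed
  then obtain r where r: "r \<in> R" "A r a \<noteq> 0" by blast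
  \<comment> \<open>\<open>A'\<close> is the Schur complement of the pivot; \<open>ext v t\<close>
    back-substitutes, choosing the entry at \<open>a\<close> such that row \<open>r\<close> takes
    the value \<open>t\<close>.\<close>
  define A' where "A' i j = A i j - A i a * A r j / A r a" for i j
  define ext where "ext v t = v(a := (t - (\<Sum>j\<in>S. A r j * v j)) / A r a)" for v t
  have row: "(\<Sum>j\<in>insert a S. A i j * ext v t j) = (\<Sum>j\<in>S. A' i j * v j) + A i a / A r a * t" for i v t
  proof -
    have "(\<Sum>j\<in>S. A i j * ext v t j) = (\<Sum>j\<in>S. A i j * v j)"
      using insert.hyps by (intro sum.cong) (auto simp: ext_def)
    then have "(\<Sum>j\<in>insert a S. A i j * ext v t j) =
        A i a * ((t - (\<Sum>j\<in>S. A r j * v j)) / A r a) + (\<Sum>j\<in>S. A i j * v j)"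
      using insert.hyps by (simp add: ext_def)
    also have "\<dots> = (\<Sum>j\<in>S. A i j * v j) - A i a / A r a * (\<Sum>j\<in>S. A r j * v j) + A i a / A r a * t"
      by (simp add: field_simps diff_divide_distrib)
    also have "(\<Sum>j\<in>S. A i j * v j) - A i a / A r a * (\<Sum>j\<in>S. A r j * v j) = (\<Sum>j\<in>S. A' i j * v j)"
      by (simp add: A'_def sum_subtractf sum_distrib_left algebra_simps)
    finally show ?thesis .
  qed
  have A'r: "A' r j = 0" for j
    using r by (simp add: A'_def)
  have inj': "\<forall>j\<in>S. v j = 0" if v: "\<And>i. i \<in> R - {r} \<Longrightarrow> (\<Sum>j\<in>S. A' i j * v j) = 0" for v
  proof -
    have "(\<Sum>j\<in>insert a S. A i j * ext v 0 j) = 0" if "i \<in> R" for i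
      using v[of i] that by (cases "i = r") (simp_all add: row A'r)
    from insert.prems(3)[OF this] show ?thesis
      using insert.hyps by (auto simp: ext_def split: if_splits)
  qed
  have "card (R - {r}) = card S"
    using insert r by simp
  from insert.IH[OF _ this inj', where y = "\<lambda>i. y i - A i a / A r a * y r"]
  obtain v where v: "\<forall>i\<in>R - {r}. (\<Sum>j\<in>S. A' i j * v j) = y i - A i a / A r a * y r"
    using insert.prems(1) by auto
  have "(\<Sum>j\<in>insert a S. A i j * ext v (y r) j) = y i" if "i \<in> R" for i
    using v that r by (cases "i = r") (simp_all add: row A'r)
  then show ?case by blast
qed

text \<open>Solving for the unit vectors gives a right inverse; it is also a left inverse because
  \<open>A\<close> annihilates the columns of \<open>V A - Id\<close> and is injective.\<close>

lemma inverse_on_of_injective: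
  assumes I: "finite I"
    and inj: "\<And>v. (\<And>i. i \<in> I \<Longrightarrow> (\<Sum>j\<in>I. A i j * v j) = 0) \<Longrightarrow> \<forall>j\<in>I. v j = 0"
  shows "\<forall>i\<in>I. \<forall>j\<in>I. (\<Sum>k\<in>I. A i k * inverse_on I A k j) = of_bool (i = j) \<and>
    (\<Sum>k\<in>I. inverse_on I A i k * A k j) = of_bool (i = j)"
proof -
  have "\<exists>v. \<forall>i\<in>I. (\<Sum>k\<in>I. A i k * v k) = of_bool (i = j)" for j
    by (rule solve_of_injective_matrix[OF I I refl]) (use inj in blast)
  then obtain V where V: "\<And>i j. i \<in> I \<Longrightarrow> (\<Sum>k\<in>I. A i k * V j k) = of_bool (i = j)"
    by metis
  have left: "(\<Sum>k\<in>I. V k i * A k j) = of_bool (i = j)" if ij: "i \<in> I" "j \<in> I" for i j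
  proof -
    have "(\<Sum>i\<in>I. A l i * ((\<Sum>k\<in>I. V k i * A k j) - of_bool (i = j))) = 0" if l: "l \<in> I" for l
    proof -
      have "(\<Sum>i\<in>I. A l i * (\<Sum>k\<in>I. V k i * A k j)) = (\<Sum>k\<in>I. (\<Sum>i\<in>I. A l i * V k i) * A k j)"
        by (simp add: sum_distrib_left sum_distrib_right mult.assoc) (rule sum.swap)
      also have "\<dots> = (\<Sum>k\<in>I. of_bool (l = k) * A k j)"
        using V l by simp
      also have "\<dots> = A l j"
        using l I by (simp add: of_bool_def if_distrib[of "\<lambda>t. t * _"] cong: if_cong)
      finally have "(\<Sum>i\<in>I. A l i * (\<Sum>k\<in>I. V k i * A k j)) = A l j" .
      moreover have "(\<Sum>i\<in>I. A l i * of_bool (i = j)) = A l j"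
        using ij I by (simp add: of_bool_def if_distrib[of "\<lambda>t. _ * t"] cong: if_cong)
      ultimately show ?thesis by (simp add: right_diff_distrib sum_subtractf)
    qed
    from inj[OF this] show ?thesis using ij by simp
  qed
  have "\<exists>B. \<forall>i\<in>I. \<forall>j\<in>I. (\<Sum>k\<in>I. A i k * B k j) = of_bool (i = j) \<and>
      (\<Sum>k\<in>I. B i k * A k j) = of_bool (i = j)"
    by (rule exI[of _ "\<lambda>i j. V j i"]) (use V left in simp)
  from someI_ex[OF this] show ?thesis
    unfolding inverse_on_def by blast
qed

lemma max_norm_equivalentE:
  assumes "finite I" "I \<noteq> {}" "max_norm_equivalent \<kappa> I N"
  obtains a where "a > 0" "1 \<le> \<kappa>" "\<And>v. a * (MAX i\<in>I. \<bar>v i\<bar>) \<le> N v"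
    "\<And>v. N v \<le> \<kappa> * a * (MAX i\<in>I. \<bar>v i\<bar>)"
proof -
  obtain a where a: "a > 0" "\<And>v. a * (MAX i\<in>I. \<bar>v i\<bar>) \<le> N v" "\<And>v. N v \<le> \<kappa> * a * (MAX i\<in>I. \<bar>v i\<bar>)"
    using assms by (auto simp: max_norm_equivalent_def)
  have *: "(MAX i\<in>I. \<bar>1\<bar>) = (1::real)" using assms by simp
  have "a * 1 \<le> \<kappa> * a * 1"
    using order_trans[OF a(2)[of "\<lambda>_. 1"] a(3)[of "\<lambda>_. 1"]] unfolding * .
  then have "1 \<le> \<kappa>" using a(1) by simp
  then show thesis using that a by blast
qed

text \<open>The real supremum is meaningful only once its range is bounded above; the equivalence
  with the maximum norm supplies that bound.\<close>

lemma norm_le_operator_norm: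
  assumes I: "finite I" "I \<noteq> {}" and N: "norm_on I N" and eq: "max_norm_equivalent \<kappa> I N"
  shows "N (\<lambda>i. \<Sum>j\<in>I. B i j * v j) \<le> operator_norm I N B * N v"
proof -
  obtain a where a: "a > 0" "1 \<le> \<kappa>" "\<And>v. a * (MAX i\<in>I. \<bar>v i\<bar>) \<le> N v"
    "\<And>v. N v \<le> \<kappa> * a * (MAX i\<in>I. \<bar>v i\<bar>)"
    using max_norm_equivalentE[OF I eq] by blast
  let ?Bv = "\<lambda>v i. \<Sum>j\<in>I. B i j * v j"
  have N0: "0 \<le> N v" "N v = 0 \<longleftrightarrow> (\<forall>i\<in>I. v i = 0)" "N (\<lambda>i. t * v i) = \<bar>t\<bar> * N v" for v t
    using N by (auto simp: norm_on_def)
  have \<kappa>: "0 \<le> \<kappa>" using a(2) by simp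
  have bdd: "bdd_above ((\<lambda>v. N (?Bv v)) ` {v. N v \<le> 1})"
  proof (rule bdd_aboveI2)
    fix v assume "v \<in> {v. N v \<le> 1}"
    then have "(MAX i\<in>I. \<bar>v i\<bar>) \<le> 1 / a"
      using a(1) a(3)[of v] by (simp add: field_simps)
    then have v: "\<bar>v j\<bar> \<le> 1 / a" if "j \<in> I" for j
      using I that by (simp add: Max_le_iff)
    have "\<bar>?Bv v i\<bar> \<le> (\<Sum>i\<in>I. \<Sum>j\<in>I. \<bar>B i j\<bar> / a)" if "i \<in> I" for i
    proof -
      have "\<bar>?Bv v i\<bar> \<le> (\<Sum>j\<in>I. \<bar>B i j\<bar> * \<bar>v j\<bar>)"
        by (rule order_trans[OF sum_abs]) (simp add: abs_mult)
      also have "\<dots> \<le> (\<Sum>j\<in>I. \<bar>B i j\<bar> / a)"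
        using v by (intro sum_mono) (metis abs_ge_zero mult_left_mono times_divide_eq_right mult.right_neutral)
      also have "\<dots> \<le> (\<Sum>i\<in>I. \<Sum>j\<in>I. \<bar>B i j\<bar> / a)"
        using I that a(1) by (intro member_le_sum) (auto intro!: sum_nonneg)
      finally show ?thesis .
    qed
    then have "(MAX i\<in>I. \<bar>?Bv v i\<bar>) \<le> (\<Sum>i\<in>I. \<Sum>j\<in>I. \<bar>B i j\<bar> / a)"
      using I by (simp add: Max_le_iff)
    then have "\<kappa> * a * (MAX i\<in>I. \<bar>?Bv v i\<bar>) \<le> \<kappa> * a * (\<Sum>i\<in>I. \<Sum>j\<in>I. \<bar>B i j\<bar> / a)"
      using \<kappa> a(1) by (intro mult_left_mono) auto
    then show "N (?Bv v) \<le> \<kappa> * a * (\<Sum>i\<in>I. \<Sum>j\<in>I. \<bar>B i j\<bar> / a)"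
      using a(4)[of "?Bv v"] by linarith
  qed
  show ?thesis
  proof (cases "N v = 0")
    case True
    then have "N (?Bv v) = 0"
      by (simp add: N0(2))
    with True show ?thesis by simp
  next
    case False
    then have pos: "N v > 0" using N0(1)[of v] by simp
    let ?u = "\<lambda>i. 1 / N v * v i"
    have "N ?u \<le> 1" using pos by (simp only: N0(3)) simp
    then have "N (?Bv ?u) \<le> operator_norm I N B"
      unfolding operator_norm_def by (intro cSUP_upper[OF _ bdd]) simp
    moreover have "?Bv ?u = (\<lambda>i. 1 / N v * ?Bv v i)"
      by (simp add: sum_distrib_left ac_simps)
    ultimately show ?thesis
      using pos by (simp only: N0(3)) (simp add: field_simps)
  qed
qed

text \<open>The scale \<open>a\<close> of the equivalence occurs on both sides and cancels, so
  passing from \<open>N\<close> to the maximum norm costs just the factor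
  \<open>\<kappa>\<close>.\<close>

lemma max_norm_equivalent_operator_norm_bound:
  assumes I: "finite I" "I \<noteq> {}" and N: "norm_on I N" and eq: "max_norm_equivalent \<kappa> I N"
    and C: "operator_norm I N B \<le> C" "0 \<le> C"
    and v: "\<And>i. i \<in> I \<Longrightarrow> \<bar>v i\<bar> \<le> t" and i: "i \<in> I"
  shows "\<bar>\<Sum>j\<in>I. B i j * v j\<bar> \<le> \<kappa> * C * t"
proof -
  obtain a where a: "a > 0" "1 \<le> \<kappa>" "\<And>v. a * (MAX i\<in>I. \<bar>v i\<bar>) \<le> N v"
    "\<And>v. N v \<le> \<kappa> * a * (MAX i\<in>I. \<bar>v i\<bar>)"
    using max_norm_equivalentE[OF I eq] by blast
  have \<kappa>: "0 \<le> \<kappa> * a" using a(1,2) by simp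
  have "a * \<bar>\<Sum>j\<in>I. B i j * v j\<bar> \<le> a * (MAX i\<in>I. \<bar>\<Sum>j\<in>I. B i j * v j\<bar>)"
    using I i a(1) by (intro mult_left_mono) auto
  also have "\<dots> \<le> N (\<lambda>i. \<Sum>j\<in>I. B i j * v j)"
    by (rule a(3))
  also have "\<dots> \<le> operator_norm I N B * N v"
    by (rule norm_le_operator_norm[OF I N eq])
  also have "\<dots> \<le> C * N v"
    using C N by (intro mult_right_mono) (auto simp: norm_on_def)
  also have "\<dots> \<le> C * (\<kappa> * a * (MAX i\<in>I. \<bar>v i\<bar>))"
    using C a(4) by (intro mult_left_mono)
  also have "\<dots> \<le> C * (\<kappa> * a * t)"
    using C \<kappa> I v by (intro mult_left_mono) (auto simp: Max_le_iff)
  finally have "a * \<bar>\<Sum>j\<in>I. B i j * v j\<bar> \<le> a * (\<kappa> * C * t)"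
    by (simp add: ac_simps)
  then show ?thesis using a(1) by simp
qed

section \<open>The kernel and its Poisson equation\<close>

lemma accept_pos: "0 < r \<Longrightarrow> 0 < accept rule r"
  by (cases rule) auto

lemma accept_le_1: "0 < r \<Longrightarrow> accept rule r \<le> 1"
  by (cases rule) auto

lemma accept_mono: "0 < r \<Longrightarrow> r \<le> r' \<Longrightarrow> accept rule r \<le> accept rule r'"
  by (cases rule) (auto simp: field_simps)

lemma accept_mult_le: "0 < r \<Longrightarrow> 1 \<le> l \<Longrightarrow> accept rule (l * r) \<le> l * accept rule r"
proof (cases rule)
  case Metropolis_Hastings
  assume "0 < r" "1 \<le> l"
  then show ?thesis
    using mult_mono[of 1 l 1 r] by (auto simp: Metropolis_Hastings min_def)
next
  case Barker
  assume *: "0 < r" "1 \<le> l"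
  then have "r \<le> l * r" by simp
  with * have "l * r / (1 + l * r) \<le> l * r / (1 + r)"
    by (intro divide_left_mono) (auto intro!: mult_pos_pos add_pos_pos)
  then show ?thesis by (simp add: Barker)
qed

text \<open>Both sides equal \<open>min a b\<close> for Metropolis-Hastings and
  \<open>a * b / (a + b)\<close> for Barker.\<close>

lemma accept_balance: "0 < a \<Longrightarrow> 0 < b \<Longrightarrow> a * accept rule (b / a) = b * accept rule (a / b)"
  by (cases rule) (auto simp: min_def field_simps)

text \<open>The acceptance probability, as a function of the log-ratio, is nonexpansive because it is
  nondecreasing, at most 1 and grows at most linearly in the ratio.\<close>

lemma accept_exp_lipschitz:
  assumes "0 < r"
  shows "\<bar>accept rule (r * exp u) - accept rule (r * exp v)\<bar> \<le> \<bar>u - v\<bar>"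
proof -
  have *: "\<bar>accept rule (r * exp u) - accept rule (r * exp v)\<bar> \<le> \<bar>u - v\<bar>" if "v \<le> u" for u v
  proof -
    let ?a = "accept rule (r * exp u)" and ?b = "accept rule (r * exp v)"
    have "?a = accept rule (exp (u - v) * (r * exp v))"
      by (simp add: exp_diff mult.commute)
    also have "\<dots> \<le> exp (u - v) * ?b"
      using assms that by (intro accept_mult_le) auto
    finally have "exp (- (u - v)) * ?a \<le> ?b"
      by (simp add: exp_minus exp_diff field_simps)
    moreover have "(1 - (u - v)) * ?a \<le> exp (- (u - v)) * ?a"
    proof (rule mult_right_mono)
      show "1 - (u - v) \<le> exp (- (u - v))" using exp_ge_add_one_self[of "- (u - v)"] by linarith
      show "0 \<le> ?a" using accept_pos[of "r * exp u" rule] assms by simp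
    qed
    moreover have "(u - v) * ?a \<le> (u - v) * 1"
      using that assms by (intro mult_left_mono accept_le_1) auto
    moreover have "?b \<le> ?a"
      using assms that by (intro accept_mono) auto
    ultimately show ?thesis
      by (simp add: left_diff_distrib)
  qed
  show ?thesis
    using *[of v u] *[of u v] by (cases "v \<le> u") auto
qed

locale proposal_kernel =
  fixes I :: "'i set" and q :: "'i \<Rightarrow> 'i \<Rightarrow> real" and rule :: acceptance_rule
  assumes finite_I: "finite I" and nonempty_I: "I \<noteq> {}"
    and q_pos: "i \<in> I \<Longrightarrow> j \<in> I \<Longrightarrow> 0 < q j i"
    and q_sum: "i \<in> I \<Longrightarrow> (\<Sum>j\<in>I. q j i) = 1"
begin

abbreviation p where "p \<equiv> gibbs I"
abbreviation P where "P \<equiv> transition rule I q"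

lemma partition_pos: "0 < (\<Sum>j\<in>I. exp (s j / w :: real))"
  using finite_I nonempty_I by (intro sum_pos) auto

lemma gibbs_pos: "0 < p w s i"
  using partition_pos[of s w] by (simp add: gibbs_def)

lemma gibbs_sum: "(\<Sum>i\<in>I. p w s i) = 1"
  using partition_pos[of s w] by (simp add: gibbs_def flip: sum_divide_distrib)

lemma accept_prob_eq:
  assumes "i \<in> I" "j \<in> I"
  shows "accept_prob rule I q w s i j = accept rule (q i j / q j i * exp (s j / w - s i / w))"
  using partition_pos[of s w] by (simp add: accept_prob_def gibbs_def exp_diff field_simps)

lemma accept_prob_bounds:
  assumes "i \<in> I" "j \<in> I"
  shows "0 < accept_prob rule I q w s i j" "accept_prob rule I q w s i j \<le> 1"
  using q_pos[OF assms] q_pos[OF assms(2,1)]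
  unfolding accept_prob_eq[OF assms] by (auto intro!: accept_pos accept_le_1)

text \<open>Proposing \<open>i\<close> itself never leaves \<open>i\<close>, so the mass
  \<open>q i i\<close> stays on the diagonal. All entries of the kernel are therefore positive, and
  the maximum principle needs a single step.\<close>

lemma transition_off_diagonal_sum_le:
  assumes "i \<in> I"
  shows "(\<Sum>k\<in>I - {i}. q k i * accept_prob rule I q w s i k) \<le> 1 - q i i"
proof -
  have "(\<Sum>k\<in>I - {i}. q k i * accept_prob rule I q w s i k) \<le> (\<Sum>k\<in>I - {i}. q k i)"
    using assms by (intro sum_mono mult_left_le) (auto simp: accept_prob_bounds less_imp_le q_pos)
  also have "\<dots> = 1 - q i i"
    using sum.remove[OF finite_I assms, of "\<lambda>k. q k i"] q_sum[OF assms] by simp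
  finally show ?thesis .
qed

lemma transition_pos:
  assumes "i \<in> I" "j \<in> I"
  shows "0 < P w s i j"
proof (cases "j = i")
  case True
  then show ?thesis
    using transition_off_diagonal_sum_le[OF assms(1), of w s] q_pos[OF assms(1,1)]
    by (simp add: transition_def)
next
  case False
  then show ?thesis
    using accept_prob_bounds(1)[OF assms] q_pos[OF assms] by (simp add: transition_def)
qed

lemma transition_sum:
  assumes "i \<in> I"
  shows "(\<Sum>j\<in>I. P w s i j) = 1"
  using sum.remove[OF finite_I assms, of "P w s i"]
  by (simp add: transition_def)

lemma detailed_balance:
  assumes "i \<in> I" "j \<in> I"
  shows "p w s i * P w s i j = p w s j * P w s j i"
proof (cases "i = j")
  case False
  then show ?thesis
    using accept_balance[of "p w s i * q j i" "p w s j * q i j" rule] q_pos[OF assms] q_pos[OF assms(2,1)]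
    by (simp add: transition_def accept_prob_def gibbs_pos mult.assoc)
qed simp

lemma gibbs_stationary:
  assumes "j \<in> I"
  shows "(\<Sum>i\<in>I. p w s i * P w s i j) = p w s j"
proof -
  have "(\<Sum>i\<in>I. p w s i * P w s i j) = (\<Sum>i\<in>I. p w s j * P w s j i)"
    using assms by (intro sum.cong detailed_balance) auto
  also have "\<dots> = p w s j"
    using transition_sum[OF assms] by (simp flip: sum_distrib_left)
  finally show ?thesis .
qed

lemma gibbs_transition_sum:
  "(\<Sum>i\<in>I. p w s i * (\<Sum>j\<in>I. P w s i j * v j)) = (\<Sum>j\<in>I. p w s j * v j)"
proof -
  have "(\<Sum>i\<in>I. p w s i * (\<Sum>j\<in>I. P w s i j * v j)) = (\<Sum>j\<in>I. (\<Sum>i\<in>I. p w s i * P w s i j) * v j)"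
    by (simp add: sum_distrib_left sum_distrib_right mult.assoc) (rule sum.swap)
  also have "\<dots> = (\<Sum>j\<in>I. p w s j * v j)"
    by (simp add: gibbs_stationary)
  finally show ?thesis .
qed

definition poisson where
  "poisson w s i j = of_bool (i = j) - P w s i j + p w s j"

lemma poisson_apply:
  assumes "i \<in> I"
  shows "(\<Sum>j\<in>I. poisson w s i j * v j) = v i - (\<Sum>j\<in>I. P w s i j * v j) + (\<Sum>j\<in>I. p w s j * v j)"
  using assms finite_I
  by (simp add: poisson_def distrib_right left_diff_distrib sum.distrib sum_subtractf of_bool_def
      if_distrib[of "\<lambda>t. t * _"] cong: if_cong)

text \<open>By stationarity \<open>p\<close> is a left eigenvector of Id - P + 1 p' with eigenvalue
  1. Hence a solution \<open>v\<close> has the same Gibbs mean as the right-hand side y, and it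
  solves the usual Poisson equation (Id - P) v = y - mean of y.\<close>

lemma gibbs_poisson_apply:
  "(\<Sum>i\<in>I. p w s i * (\<Sum>j\<in>I. poisson w s i j * v j)) = (\<Sum>j\<in>I. p w s j * v j)"
proof -
  have "(\<Sum>i\<in>I. p w s i * (\<Sum>j\<in>I. poisson w s i j * v j)) =
      (\<Sum>i\<in>I. p w s i * v i - p w s i * (\<Sum>j\<in>I. P w s i j * v j) + p w s i * (\<Sum>j\<in>I. p w s j * v j))"
    by (intro sum.cong refl) (simp add: poisson_apply distrib_left right_diff_distrib)
  also have "\<dots> = (\<Sum>j\<in>I. p w s j * v j)"
    by (simp add: sum.distrib sum_subtractf gibbs_transition_sum gibbs_sum flip: sum_distrib_right)
  finally show ?thesis .
qed

text \<open>A kernel vector v has p-mean 0 and is harmonic for P, hence constant by the maximum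
  principle, hence 0.\<close>

lemma poisson_injective:
  assumes v: "\<And>i. i \<in> I \<Longrightarrow> (\<Sum>j\<in>I. poisson w s i j * v j) = 0"
  shows "\<forall>j\<in>I. v j = 0"
proof -
  have mean: "(\<Sum>j\<in>I. p w s j * v j) = 0"
    using gibbs_poisson_apply[of w s v] v by simp
  have harm: "v i = (\<Sum>j\<in>I. P w s i j * v j)" if "i \<in> I" for i
    using v[OF that] mean by (simp add: poisson_apply[OF that])
  obtain m where m: "m \<in> I" "\<And>j. j \<in> I \<Longrightarrow> v j \<le> v m"
    using Max_in[of "v ` I"] Max_ge[of "v ` I"] finite_I nonempty_I by fastforce
  have "(\<Sum>j\<in>I. P w s m j * (v m - v j)) = 0"
    using harm[OF m(1)] transition_sum[OF m(1)]
    by (simp add: right_diff_distrib sum_subtractf flip: sum_distrib_right)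
  then have "\<forall>j\<in>I. P w s m j * (v m - v j) = 0"
    using m transition_pos[OF m(1), THEN less_imp_le] finite_I
    by (subst (asm) sum_nonneg_eq_0_iff) auto
  then have const: "\<forall>j\<in>I. v j = v m"
    using transition_pos[OF m(1), of _ w s] by force
  then have "(\<Sum>j\<in>I. p w s j * v j) = (\<Sum>j\<in>I. p w s j) * v m"
    unfolding sum_distrib_right by (intro sum.cong) auto
  with mean const show ?thesis by (simp add: gibbs_sum)
qed

lemma fundamental_matrix_eq: "fundamental_matrix rule I q w s = inverse_on I (poisson w s)"
  by (simp add: fundamental_matrix_def poisson_def[abs_def])

lemma fundamental_matrix_inverse:
  assumes "i \<in> I" "j \<in> I"
  shows "(\<Sum>k\<in>I. poisson w s i k * fundamental_matrix rule I q w s k j) = of_bool (i = j)"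
    "(\<Sum>k\<in>I. fundamental_matrix rule I q w s i k * poisson w s k j) = of_bool (i = j)"
proof -
  have "\<forall>i\<in>I. \<forall>j\<in>I. (\<Sum>k\<in>I. poisson w s i k * inverse_on I (poisson w s) k j) = of_bool (i = j) \<and>
      (\<Sum>k\<in>I. inverse_on I (poisson w s) i k * poisson w s k j) = of_bool (i = j)"
    by (rule inverse_on_of_injective[OF finite_I]) (rule poisson_injective)
  then show "(\<Sum>k\<in>I. poisson w s i k * fundamental_matrix rule I q w s k j) = of_bool (i = j)"
    "(\<Sum>k\<in>I. fundamental_matrix rule I q w s i k * poisson w s k j) = of_bool (i = j)"
    using assms unfolding fundamental_matrix_eq by auto
qed

lemma poisson_solution:
  obtains v where "\<And>i. i \<in> I \<Longrightarrow> (\<Sum>j\<in>I. poisson w s i j * v j) = y i"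
proof
  fix i assume i: "i \<in> I"
  let ?B = "fundamental_matrix rule I q w s"
  have "(\<Sum>j\<in>I. poisson w s i j * (\<Sum>k\<in>I. ?B j k * y k)) =
      (\<Sum>k\<in>I. (\<Sum>j\<in>I. poisson w s i j * ?B j k) * y k)"
    by (simp add: sum_distrib_left sum_distrib_right mult.assoc) (rule sum.swap)
  also have "\<dots> = y i"
    using i finite_I
    by (simp add: fundamental_matrix_inverse of_bool_def if_distrib[of "\<lambda>t. t * _"] cong: if_cong)
  finally show "(\<Sum>j\<in>I. poisson w s i j * (\<Sum>k\<in>I. ?B j k * y k)) = y i" .
qed

text \<open>The left inverse turns the norm bound into an a priori estimate in the maximum norm for
  every \<open>v\<close>; it is applied to solutions and to differences of solutions.\<close>

lemma poisson_stable:
  assumes N: "norm_on I N" "max_norm_equivalent \<kappa> I N"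
    and C: "operator_norm I N (fundamental_matrix rule I q w s) \<le> C" "0 \<le> C"
    and v: "\<And>i. i \<in> I \<Longrightarrow> \<bar>\<Sum>j\<in>I. poisson w s i j * v j\<bar> \<le> t"
    and i: "i \<in> I"
  shows "\<bar>v i\<bar> \<le> \<kappa> * C * t"
proof -
  let ?B = "fundamental_matrix rule I q w s"
  have "(\<Sum>k\<in>I. ?B i k * (\<Sum>j\<in>I. poisson w s k j * v j)) =
      (\<Sum>j\<in>I. (\<Sum>k\<in>I. ?B i k * poisson w s k j) * v j)"
    by (simp add: sum_distrib_left sum_distrib_right mult.assoc) (rule sum.swap)
  also have "\<dots> = v i"
    using i finite_I
    by (simp add: fundamental_matrix_inverse of_bool_def if_distrib[of "\<lambda>t. t * _"] cong: if_cong)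
  finally have eq: "(\<Sum>k\<in>I. ?B i k * (\<Sum>j\<in>I. poisson w s k j * v j)) = v i" .
  have "\<bar>\<Sum>k\<in>I. ?B i k * (\<Sum>j\<in>I. poisson w s k j * v j)\<bar> \<le> \<kappa> * C * t"
    by (rule max_norm_equivalent_operator_norm_bound[OF finite_I nonempty_I N C v i])
  then show ?thesis by (simp only: eq)
qed

text \<open>The constant vector 1 is fixed by Id - P + 1 p', hence by its inverse.\<close>

lemma fundamental_matrix_norm_ge_1:
  assumes N: "norm_on I N" "max_norm_equivalent \<kappa> I N"
  shows "1 \<le> operator_norm I N (fundamental_matrix rule I q w s)"
proof -
  let ?B = "fundamental_matrix rule I q w s" and ?u = "\<lambda>i. of_bool (i \<in> I) :: real"
  have 1: "(\<Sum>j\<in>I. ?B i j) = 1" if i: "i \<in> I" for i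
  proof -
    have "(\<Sum>j\<in>I. ?B i j) = (\<Sum>k\<in>I. ?B i k * (\<Sum>j\<in>I. poisson w s k j * 1))"
      by (intro sum.cong refl) (subst poisson_apply, simp_all add: transition_sum gibbs_sum)
    also have "\<dots> = (\<Sum>j\<in>I. \<Sum>k\<in>I. ?B i k * poisson w s k j)"
      by (simp add: sum_distrib_left) (rule sum.swap)
    also have "\<dots> = 1"
      using i finite_I by (simp add: fundamental_matrix_inverse of_bool_def)
    finally show ?thesis .
  qed
  have N': "0 \<le> N v" "N v = 0 \<longleftrightarrow> (\<forall>i\<in>I. v i = 0)" "N (\<lambda>i. c * v i) = \<bar>c\<bar> * N v"
    "N (\<lambda>i. u i + v i) \<le> N u + N v" for u v c
    using N(1) by (auto simp: norm_on_def)
  let ?Bu = "\<lambda>i. \<Sum>j\<in>I. ?B i j * ?u j"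
  \<comment> \<open>\<open>?Bu\<close> and \<open>?u\<close> agree on \<open>I\<close> but may
    differ elsewhere; the triangle inequality transfers \<open>N\<close> from one to the
    other.\<close>
  have "N ?u \<le> N ?Bu + N (\<lambda>i. ?u i + - ?Bu i)"
    using N'(4)[of ?Bu "\<lambda>i. ?u i + - ?Bu i"] by simp
  also have "N (\<lambda>i. ?u i + - ?Bu i) = 0"
    unfolding N'(2) using 1 by simp
  also have "N ?Bu \<le> operator_norm I N ?B * N ?u"
    by (rule norm_le_operator_norm[OF finite_I nonempty_I N])
  finally have "1 * N ?u \<le> operator_norm I N ?B * N ?u" by simp
  moreover have "0 < N ?u"
    using N'(1,2)[of ?u] nonempty_I by (auto simp: order_less_le)
  ultimately show ?thesis by (simp only: mult_le_cancel_right_pos)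
qed

section \<open>Perturbation of scores and temperature\<close>

context
  fixes w w' \<epsilon> :: real and s s' :: "'i \<Rightarrow> real"
  assumes close: "\<And>i. i \<in> I \<Longrightarrow> \<bar>s i / w - s' i / w'\<bar> \<le> \<epsilon>"
begin

lemma eps_nonneg: "0 \<le> \<epsilon>"
  using close nonempty_I by fastforce

text \<open>An acceptance log-ratio is a difference of two exponents and changes by at most
  \<open>2 * \<epsilon>\<close>; the proposal weights sum to 1, so the off-diagonal part of a row
  changes by \<open>2 * \<epsilon>\<close> in total. As rows sum to 1, the diagonal entry changes by
  no more than that, giving 2 + 2.\<close>

lemma transition_perturbation:
  assumes i: "i \<in> I" and v: "\<And>j. j \<in> I \<Longrightarrow> \<bar>v j\<bar> \<le> t"
  shows "\<bar>(\<Sum>j\<in>I. P w s i j * v j) - (\<Sum>j\<in>I. P w' s' i j * v j)\<bar> \<le> 4 * \<epsilon> * t"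
proof -
  have t: "0 \<le> t" using v nonempty_I by fastforce
  let ?d = "\<lambda>j. accept_prob rule I q w s i j - accept_prob rule I q w' s' i j"
  have d: "\<bar>?d j\<bar> \<le> 2 * \<epsilon>" if "j \<in> I" for j
  proof -
    have "\<bar>?d j\<bar> \<le> \<bar>(s j / w - s i / w) - (s' j / w' - s' i / w')\<bar>"
      unfolding accept_prob_eq[OF i that]
      using q_pos[OF i that] q_pos[OF that i] by (intro accept_exp_lipschitz) simp
    then show ?thesis using close[OF i] close[OF that] by linarith
  qed
  let ?D = "\<lambda>j. P w s i j - P w' s' i j"
  have off: "(\<Sum>j\<in>I - {i}. \<bar>?D j\<bar>) \<le> 2 * \<epsilon>"
  proof -
    have "(\<Sum>j\<in>I - {i}. \<bar>?D j\<bar>) = (\<Sum>j\<in>I - {i}. q j i * \<bar>?d j\<bar>)"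
      using i by (intro sum.cong) (auto simp: transition_def q_pos less_imp_le abs_mult simp flip: right_diff_distrib)
    also have "\<dots> \<le> (\<Sum>j\<in>I - {i}. q j i * (2 * \<epsilon>))"
      using i d by (intro sum_mono mult_left_mono) (auto simp: q_pos less_imp_le)
    also have "\<dots> \<le> (\<Sum>j\<in>I. q j i * (2 * \<epsilon>))"
      using i finite_I eps_nonneg by (intro sum_mono2) (auto simp: q_pos less_imp_le)
    also have "\<dots> = 2 * \<epsilon>"
      using q_sum[OF i] by (simp flip: sum_distrib_right)
    finally show ?thesis .
  qed
  have "?D i = - (\<Sum>j\<in>I - {i}. ?D j)"
    using sum.remove[OF finite_I i, of ?D] transition_sum[OF i] by (simp add: sum_subtractf)
  then have diag: "\<bar>?D i\<bar> \<le> 2 * \<epsilon>"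
    using off sum_abs[of ?D "I - {i}"] by linarith
  have "\<bar>(\<Sum>j\<in>I. P w s i j * v j) - (\<Sum>j\<in>I. P w' s' i j * v j)\<bar> = \<bar>\<Sum>j\<in>I. ?D j * v j\<bar>"
    by (simp add: left_diff_distrib sum_subtractf)
  also have "\<dots> \<le> (\<Sum>j\<in>I. \<bar>?D j\<bar> * t)"
    by (rule order_trans[OF sum_abs]) (auto simp: abs_mult intro!: sum_mono mult_left_mono v)
  also have "\<dots> = (\<bar>?D i\<bar> + (\<Sum>j\<in>I - {i}. \<bar>?D j\<bar>)) * t"
    using sum.remove[OF finite_I i, of "\<lambda>j. \<bar>?D j\<bar>"] by (simp flip: sum_distrib_right)
  also have "\<dots> \<le> (4 * \<epsilon>) * t"
    using off diag t by (intro mult_right_mono) auto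
  finally show ?thesis .
qed

text \<open>One factor \<open>exp (- \<epsilon>)\<close> comes from the numerator, the other from
  the partition function.\<close>

lemma gibbs_ratio_le:
  assumes "i \<in> I"
  shows "exp (- 2 * \<epsilon>) * p w s i \<le> p w' s' i"
proof -
  have "(\<Sum>j\<in>I. exp (s' j / w')) \<le> (\<Sum>j\<in>I. exp \<epsilon> * exp (s j / w))"
    using close by (intro sum_mono) (force simp flip: exp_add simp: abs_le_iff)
  then have Z: "(\<Sum>j\<in>I. exp (s' j / w')) \<le> exp \<epsilon> * (\<Sum>j\<in>I. exp (s j / w))"
    by (simp add: sum_distrib_left)
  have "exp (- 2 * \<epsilon>) * p w s i = exp (s i / w - \<epsilon>) / (exp \<epsilon> * (\<Sum>j\<in>I. exp (s j / w)))"
  proof -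
    have "exp (- 2 * \<epsilon>) = exp (- \<epsilon>) / exp \<epsilon>" by (simp flip: exp_diff)
    then show ?thesis by (simp add: gibbs_def exp_diff exp_minus field_simps)
  qed
  also have "\<dots> \<le> exp (s' i / w') / (\<Sum>j\<in>I. exp (s' j / w'))"
    using Z partition_pos close[OF assms] by (intro frac_le) (auto simp: abs_le_iff)
  finally show ?thesis by (simp add: gibbs_def)
qed

end

text \<open>Comparing by ratios and using 1 - exp (- 2 \<epsilon>) \<le> 2 \<epsilon> makes the
  error at \<open>j\<close> proportional to the masses at \<open>j\<close>, which sum to 2 over both
  laws whatever the size of \<open>I\<close>.\<close>

lemma gibbs_perturbation:
  assumes close: "\<And>i. i \<in> I \<Longrightarrow> \<bar>s i / w - s' i / w'\<bar> \<le> \<epsilon>" and v: "\<And>j. j \<in> I \<Longrightarrow> \<bar>v j\<bar> \<le> t"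
  shows "\<bar>(\<Sum>j\<in>I. p w s j * v j) - (\<Sum>j\<in>I. p w' s' j * v j)\<bar> \<le> 4 * \<epsilon> * t"
proof -
  have t: "0 \<le> t" using v nonempty_I by fastforce
  have close': "\<bar>s' i / w' - s i / w\<bar> \<le> \<epsilon>" if "i \<in> I" for i
    using close[OF that] by linarith
  have d: "\<bar>p w s j - p w' s' j\<bar> \<le> 2 * \<epsilon> * (p w s j + p w' s' j)" if "j \<in> I" for j
  proof -
    have lin: "a - b \<le> 2 * \<epsilon> * a" if "exp (- 2 * \<epsilon>) * a \<le> b" "0 < a" for a b
      using that exp_ge_add_one_self[of "- 2 * \<epsilon>"] mult_right_mono[of "1 + - 2 * \<epsilon>" "exp (- 2 * \<epsilon>)" a]
      by (auto simp: algebra_simps)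
    have "p w s j - p w' s' j \<le> 2 * \<epsilon> * p w s j"
      by (intro lin gibbs_ratio_le[OF close that] gibbs_pos)
    moreover have "p w' s' j - p w s j \<le> 2 * \<epsilon> * p w' s' j"
      by (intro lin gibbs_ratio_le[OF close' that] gibbs_pos)
    moreover have "0 \<le> 2 * \<epsilon> * p w s j" "0 \<le> 2 * \<epsilon> * p w' s' j"
      using eps_nonneg[OF close] by (auto simp: gibbs_pos less_imp_le)
    ultimately show ?thesis by (simp add: distrib_left)
  qed
  have "\<bar>(\<Sum>j\<in>I. p w s j * v j) - (\<Sum>j\<in>I. p w' s' j * v j)\<bar> = \<bar>\<Sum>j\<in>I. (p w s j - p w' s' j) * v j\<bar>"
    by (simp add: left_diff_distrib sum_subtractf)
  also have "\<dots> \<le> (\<Sum>j\<in>I. 2 * \<epsilon> * (p w s j + p w' s' j) * t)"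
    by (rule order_trans[OF sum_abs]) (auto simp: abs_mult intro!: sum_mono mult_mono v d t mult_nonneg_nonneg
        eps_nonneg[OF close] add_nonneg_nonneg gibbs_pos[THEN less_imp_le])
  also have "\<dots> = 4 * \<epsilon> * t"
    by (simp add: sum.distrib gibbs_sum flip: sum_distrib_left sum_distrib_right)
  finally show ?thesis .
qed

text \<open>The solutions of the two Poisson equations differ by the solution for the second kernel of
  the right-hand side y' - y + (A - A') v.\<close>

lemma poisson_solution_perturbation:
  assumes close: "\<And>i. i \<in> I \<Longrightarrow> \<bar>s i / w - s' i / w'\<bar> \<le> \<epsilon>"
    and R: "1 \<le> R"
    and stable: "\<And>v t i. (\<And>i. i \<in> I \<Longrightarrow> \<bar>\<Sum>j\<in>I. poisson w s i j * v j\<bar> \<le> t) \<Longrightarrow> i \<in> I \<Longrightarrow> \<bar>v i\<bar> \<le> R * t"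
    and stable': "\<And>v t i. (\<And>i. i \<in> I \<Longrightarrow> \<bar>\<Sum>j\<in>I. poisson w' s' i j * v j\<bar> \<le> t) \<Longrightarrow> i \<in> I \<Longrightarrow> \<bar>v i\<bar> \<le> R * t"
    and v: "\<And>i. i \<in> I \<Longrightarrow> (\<Sum>j\<in>I. poisson w s i j * v j) = y i"
    and v': "\<And>i. i \<in> I \<Longrightarrow> (\<Sum>j\<in>I. poisson w' s' i j * v' j) = y' i"
    and y: "\<And>i. i \<in> I \<Longrightarrow> \<bar>y i\<bar> \<le> b" and d: "\<And>i. i \<in> I \<Longrightarrow> \<bar>y' i - y i\<bar> \<le> \<delta>"
    and i: "i \<in> I"
  shows "\<bar>(\<Sum>j\<in>I. P w' s' i j * v' j) - (\<Sum>j\<in>I. P w s i j * v j)\<bar> \<le> R * \<delta> + 12 * R\<^sup>2 * \<epsilon> * b"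
proof -
  have vb: "\<bar>v j\<bar> \<le> R * b" if "j \<in> I" for j
    using stable[of v b] v y that by simp
  have eps: "0 \<le> \<epsilon>" by (rule eps_nonneg[OF close])
  have b: "0 \<le> b" using y[OF i] by simp
  have P_diff: "\<bar>(\<Sum>j\<in>I. P w s k j * v j) - (\<Sum>j\<in>I. P w' s' k j * v j)\<bar> \<le> 4 * \<epsilon> * (R * b)"
    if "k \<in> I" for k
    by (rule transition_perturbation) (use close vb that in auto)
  have p_diff: "\<bar>(\<Sum>j\<in>I. p w s j * v j) - (\<Sum>j\<in>I. p w' s' j * v j)\<bar> \<le> 4 * \<epsilon> * (R * b)"
    by (rule gibbs_perturbation) (use close vb in auto)
  \<comment> \<open>The 8 is 4 from the kernel and 4 from the Gibbs law, both acting on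
    \<open>v\<close>, whose entries are at most \<open>R * b\<close>.\<close>
  have "\<bar>\<Sum>j\<in>I. poisson w' s' k j * (v' j - v j)\<bar> \<le> \<delta> + 8 * \<epsilon> * (R * b)" if k: "k \<in> I" for k
  proof -
    have "(\<Sum>j\<in>I. poisson w' s' k j * (v' j - v j)) = (y' k - y k) +
        ((\<Sum>j\<in>I. poisson w s k j * v j) - (\<Sum>j\<in>I. poisson w' s' k j * v j))"
      using v[OF k] v'[OF k] by (simp add: right_diff_distrib sum_subtractf)
    also have "\<dots> = (y' k - y k) - ((\<Sum>j\<in>I. P w s k j * v j) - (\<Sum>j\<in>I. P w' s' k j * v j)) +
        ((\<Sum>j\<in>I. p w s j * v j) - (\<Sum>j\<in>I. p w' s' j * v j))"
      by (simp add: poisson_apply[OF k])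
    finally show ?thesis
      using d[OF k] P_diff[OF k] p_diff by linarith
  qed
  note diff = stable'[OF this]
  have "\<bar>\<Sum>j\<in>I. P w' s' i j * (v' j - v j)\<bar> \<le> R * (\<delta> + 8 * \<epsilon> * (R * b))"
  proof -
    have "\<bar>\<Sum>j\<in>I. P w' s' i j * (v' j - v j)\<bar> \<le> (\<Sum>j\<in>I. P w' s' i j * (R * (\<delta> + 8 * \<epsilon> * (R * b))))"
      by (rule order_trans[OF sum_abs])
        (auto simp: abs_mult transition_pos[OF i] intro!: sum_mono mult_mono diff transition_pos[OF i, THEN less_imp_le])
    then show ?thesis using transition_sum[OF i] by (simp flip: sum_distrib_right)
  qed
  moreover have "(\<Sum>j\<in>I. P w' s' i j * v' j) - (\<Sum>j\<in>I. P w s i j * v j) =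
      (\<Sum>j\<in>I. P w' s' i j * (v' j - v j)) - ((\<Sum>j\<in>I. P w s i j * v j) - (\<Sum>j\<in>I. P w' s' i j * v j))"
    by (simp add: right_diff_distrib sum_subtractf)
  \<comment> \<open>The kernel difference acting on \<open>v\<close> carries only one factor
    \<open>R\<close>; raising it to \<open>R\<^sup>2\<close> merges its 4 with the 8 above into
    12.\<close>
  moreover have "4 * \<epsilon> * (R * b) \<le> 4 * \<epsilon> * (R\<^sup>2 * b)"
    using R eps b by (intro mult_left_mono mult_right_mono) (auto simp: power2_eq_square)
  ultimately show ?thesis
    using P_diff[OF i] by (simp add: algebra_simps power2_eq_square)
qed

text \<open>The partition function is bounded below by the single term of \<open>j\<close>.\<close>

lemma gibbs_mass_of_gap:
  assumes i: "i \<in> I" "s i \<le> m - \<Delta>" and m: "j \<in> I" "s j = m" and w: "0 < w"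
  shows "p w s i \<le> exp (- \<Delta> / w)"
proof -
  have "exp (m / w) \<le> (\<Sum>j\<in>I. exp (s j / w))"
    using m finite_I by (auto intro!: member_le_sum)
  then have "p w s i \<le> exp (s i / w) / exp (m / w)"
    unfolding gibbs_def by (intro divide_left_mono) (auto intro!: mult_pos_pos partition_pos)
  also have "\<dots> = exp ((s i - m) / w)"
    by (simp add: diff_divide_distrib exp_diff)
  also have "\<dots> \<le> exp (- \<Delta> / w)"
  proof -
    have "(s i - m) / w \<le> - \<Delta> / w" using i w by (intro divide_right_mono) auto
    then show ?thesis by simp
  qed
  finally show ?thesis .
qed

end

section \<open>Expectations along the index process\<close>

locale index_chain = prob_space M
  for M :: "'w measure" and I :: "'i set" and J :: "nat \<Rightarrow> 'w \<Rightarrow> 'i"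
    and T :: "nat \<Rightarrow> (nat \<Rightarrow> 'i) \<Rightarrow> 'i \<Rightarrow> 'i \<Rightarrow> real" +
  assumes finite_states: "finite I"
    and chain: "adaptive_chain M I J T"
begin

text \<open>Adaptedness to the natural filtration, phrased on index paths instead of sigma-algebras:
  as the state set is finite, expectations of such functions become finite sums.\<close>

definition adapted :: "nat \<Rightarrow> ((nat \<Rightarrow> 'i) \<Rightarrow> 'b) \<Rightarrow> bool" where
  "adapted n H \<longleftrightarrow> (\<forall>js js'. (\<forall>k\<le>n. js k = js' k) \<longrightarrow> H js = H js')"

abbreviation path :: "'w \<Rightarrow> nat \<Rightarrow> 'i" where "path \<omega> \<equiv> \<lambda>k. J k \<omega>"

lemma J_measurable: "J n \<in> measurable M (count_space I)"
  using chain by (simp add: adaptive_chain_def)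

lemma J_in: "\<omega> \<in> space M \<Longrightarrow> J n \<omega> \<in> I"
  using measurable_space[OF J_measurable, of \<omega> n] by simp

lemma path_event: "{\<omega> \<in> space M. \<forall>k\<le>n. J k \<omega> = js k} \<in> events"
proof -
  have "{\<omega> \<in> space M. J k \<omega> = js k} \<in> events" for k
  proof (cases "js k \<in> I")
    case True
    have "{\<omega> \<in> space M. J k \<omega> = js k} = J k -` {js k} \<inter> space M" by auto
    then show ?thesis using measurable_sets[OF J_measurable, of "{js k}" k] True by simp
  next
    case False
    then have "{\<omega> \<in> space M. J k \<omega> = js k} = {}" using J_in[of _ k] by (metis (mono_tags, lifting) Collect_empty_eq)
    then show ?thesis by (simp only: sets.empty_sets)
  qed
  then show ?thesis by (intro sets.sets_Collect_countable_All sets.sets_Collect) auto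
qed

text \<open>Extensional functions give exactly one representative per history, so the cylinders over
  \<open>paths n\<close> partition the space.\<close>

definition paths :: "nat \<Rightarrow> (nat \<Rightarrow> 'i) set" where
  "paths n = {..n} \<rightarrow>\<^sub>E I"

lemma finite_paths: "finite (paths n)"
  unfolding paths_def using finite_states by (intro finite_PiE) auto

definition cylinder :: "nat \<Rightarrow> (nat \<Rightarrow> 'i) \<Rightarrow> 'w set" where
  "cylinder n js = {\<omega> \<in> space M. \<forall>k\<le>n. J k \<omega> = js k}"

lemma cylinder_event [measurable]: "cylinder n js \<in> events"
  unfolding cylinder_def by (rule path_event)

lemma adapted_decompose:
  fixes H :: "(nat \<Rightarrow> 'i) \<Rightarrow> real"
  assumes H: "adapted n H" and \<omega>: "\<omega> \<in> space M"
  shows "H (path \<omega>) = (\<Sum>js\<in>paths n. H js * indicator (cylinder n js) \<omega>)"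
proof -
  let ?r = "restrict (path \<omega>) {..n}"
  have mem: "?r \<in> paths n" using J_in[OF \<omega>] by (auto simp: paths_def)
  have uniq: "\<omega> \<in> cylinder n js \<longleftrightarrow> js = ?r" if "js \<in> paths n" for js
  proof
    assume "\<omega> \<in> cylinder n js"
    then show "js = ?r"
      using that mem unfolding paths_def by (intro PiE_ext[of js "{..n}" "\<lambda>_. I"]) (auto simp: cylinder_def)
  qed (auto simp: cylinder_def \<omega>)
  have "(\<Sum>js\<in>paths n. H js * indicator (cylinder n js) \<omega>) = (\<Sum>js\<in>paths n. if js = ?r then H js else 0)"
    using uniq by (intro sum.cong) (auto simp: indicator_def)
  also have "\<dots> = H ?r"
    using mem finite_paths by simp
  also have "\<dots> = H (path \<omega>)"
    using H unfolding adapted_def by (auto intro!: arg_cong[of _ _ "\<lambda>x. x"])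
  finally show ?thesis by simp
qed

lemma integrable_adapted:
  fixes H :: "(nat \<Rightarrow> 'i) \<Rightarrow> real"
  assumes "adapted n H"
  shows "integrable M (\<lambda>\<omega>. H (path \<omega>))"
proof -
  have "integrable M (\<lambda>\<omega>. \<Sum>js\<in>paths n. H js * indicator (cylinder n js) \<omega>)"
    by (intro Bochner_Integration.integrable_sum integrable_mult_right) (simp add: emeasure_eq_measure)
  then show ?thesis
    by (subst Bochner_Integration.integrable_cong[OF refl adapted_decompose[OF assms]])
qed

lemma expectation_adapted:
  fixes H :: "(nat \<Rightarrow> 'i) \<Rightarrow> real"
  assumes "adapted n H"
  shows "expectation (\<lambda>\<omega>. H (path \<omega>)) = (\<Sum>js\<in>paths n. H js * prob (cylinder n js))"
proof -
  have "expectation (\<lambda>\<omega>. H (path \<omega>)) = expectation (\<lambda>\<omega>. \<Sum>js\<in>paths n. H js * indicator (cylinder n js) \<omega>)"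
    by (intro Bochner_Integration.integral_cong refl adapted_decompose[OF assms])
  also have "\<dots> = (\<Sum>js\<in>paths n. expectation (\<lambda>\<omega>. H js * indicator (cylinder n js) \<omega>))"
    by (intro Bochner_Integration.integral_sum integrable_mult_right) (simp add: emeasure_eq_measure)
  finally show ?thesis by (simp add: Int_absorb2[OF sets.sets_into_space])
qed

text \<open>\<open>adaptive_chain\<close> prescribes the conditional law along histories of positive
  probability; along the others both sides vanish.\<close>

lemma prob_step:
  assumes js: "js \<in> paths n" and j: "j \<in> I"
  shows "prob (cylinder n js \<inter> {\<omega> \<in> space M. J (Suc n) \<omega> = j}) = prob (cylinder n js) * T n js (js n) j"
proof (cases "prob (cylinder n js) = 0")
  case True
  have "prob (cylinder n js \<inter> {\<omega> \<in> space M. J (Suc n) \<omega> = j}) \<le> prob (cylinder n js)"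
    by (rule finite_measure_mono) auto
  with True show ?thesis by (simp add: measure_le_0_iff)
next
  case False
  then have pos: "prob (cylinder n js) > 0" by (simp add: zero_less_measure_iff)
  then have "\<P>(\<omega> in M. J (Suc n) \<omega> = j \<bar> \<forall>k\<le>n. J k \<omega> = js k) = T n js (js n) j"
    using chain j by (auto simp: adaptive_chain_def cylinder_def)
  then have "prob {\<omega> \<in> space M. J (Suc n) \<omega> = j \<and> (\<forall>k\<le>n. J k \<omega> = js k)} = prob (cylinder n js) * T n js (js n) j"
    using pos by (simp add: cond_prob_def cylinder_def field_simps)
  moreover have "{\<omega> \<in> space M. J (Suc n) \<omega> = j \<and> (\<forall>k\<le>n. J k \<omega> = js k)} =
      cylinder n js \<inter> {\<omega> \<in> space M. J (Suc n) \<omega> = j}"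
    by (auto simp: cylinder_def)
  ultimately show ?thesis by simp
qed

text \<open>The tower property for one transition, as a finite sum over histories. \<open>T\<close>
  has to be adapted because the sum evaluates it at the representatives in
  \<open>paths n\<close>.\<close>

lemma expectation_step:
  fixes H :: "(nat \<Rightarrow> 'i) \<Rightarrow> 'i \<Rightarrow> real"
  assumes H: "\<And>j. adapted n (\<lambda>js. H js j)" and T: "\<And>i j. adapted n (\<lambda>js. T n js i j)"
  shows "expectation (\<lambda>\<omega>. H (path \<omega>) (J (Suc n) \<omega>)) =
    expectation (\<lambda>\<omega>. \<Sum>j\<in>I. T n (path \<omega>) (J n \<omega>) j * H (path \<omega>) j)"
proof -
  let ?C = "\<lambda>js j. cylinder n js \<inter> {\<omega> \<in> space M. J (Suc n) \<omega> = j}"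
  have C: "?C js j \<in> events" if "j \<in> I" for js j
  proof -
    have "{\<omega> \<in> space M. J (Suc n) \<omega> = j} = J (Suc n) -` {j} \<inter> space M" by auto
    then show ?thesis using measurable_sets[OF J_measurable, of "{j}" "Suc n"] that by auto
  qed
  have "H (path \<omega>) (J (Suc n) \<omega>) = (\<Sum>js\<in>paths n. \<Sum>j\<in>I. H js j * indicator (?C js j) \<omega>)" if \<omega>: "\<omega> \<in> space M" for \<omega>
  proof -
    have "H (path \<omega>) (J (Suc n) \<omega>) = (\<Sum>js\<in>paths n. H js (J (Suc n) \<omega>) * indicator (cylinder n js) \<omega>)"
      by (rule adapted_decompose[OF H \<omega>])
    also have "\<dots> = (\<Sum>js\<in>paths n. \<Sum>j\<in>I. if j = J (Suc n) \<omega> then H js j * indicator (cylinder n js) \<omega> else 0)"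
      using J_in[OF \<omega>] finite_states by simp
    also have "\<dots> = (\<Sum>js\<in>paths n. \<Sum>j\<in>I. H js j * indicator (?C js j) \<omega>)"
      using \<omega> by (intro sum.cong) (auto simp: indicator_def)
    finally show ?thesis .
  qed
  then have "expectation (\<lambda>\<omega>. H (path \<omega>) (J (Suc n) \<omega>)) =
      expectation (\<lambda>\<omega>. \<Sum>js\<in>paths n. \<Sum>j\<in>I. H js j * indicator (?C js j) \<omega>)"
    by (intro Bochner_Integration.integral_cong refl)
  also have "\<dots> = (\<Sum>js\<in>paths n. \<Sum>j\<in>I. expectation (\<lambda>\<omega>. H js j * indicator (?C js j) \<omega>))"
    using C by (subst Bochner_Integration.integral_sum)
      (auto intro!: sum.cong Bochner_Integration.integral_sum Bochner_Integration.integrable_sum integrable_mult_right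
        simp: emeasure_eq_measure)
  also have "\<dots> = (\<Sum>js\<in>paths n. \<Sum>j\<in>I. H js j * prob (?C js j))"
    using C by (intro sum.cong refl) (simp add: Int_absorb2[OF sets.sets_into_space])
  also have "\<dots> = (\<Sum>js\<in>paths n. (\<Sum>j\<in>I. T n js (js n) j * H js j) * prob (cylinder n js))"
    by (intro sum.cong refl) (simp add: prob_step sum_distrib_left ac_simps)
  also have "\<dots> = expectation (\<lambda>\<omega>. \<Sum>j\<in>I. T n (path \<omega>) (J n \<omega>) j * H (path \<omega>) j)"
  proof (rule expectation_adapted[symmetric])
    show "adapted n (\<lambda>js. \<Sum>j\<in>I. T n js (js n) j * H js j)"
      unfolding adapted_def
    proof (intro allI impI sum.cong refl)
      fix js js' :: "nat \<Rightarrow> 'i" and j assume *: "\<forall>k\<le>n. js k = js' k"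
      then have "T n js (js n) j = T n js' (js' n) j" "H js j = H js' j"
        using T[of "js n" j] H[of j] unfolding adapted_def by auto
      then show "T n js (js n) j * H js j = T n js' (js' n) j * H js' j" by simp
    qed
  qed
  finally show ?thesis .
qed

end

section \<open>Rates of weighted averages\<close>

text \<open>Summation by parts: since the weights grow, each weight increment is charged against the
  nonnegative quantity \<open>m - d (Suc n)\<close>.\<close>

lemma sum_weighted_differences_le:
  fixes d w :: "nat \<Rightarrow> real"
  assumes d: "\<And>k. d k \<le> m" and w: "\<And>k. w k \<le> w (Suc k)" "0 \<le> w 0"
  shows "(\<Sum>k=1..n. w k * (d k - d (Suc k))) \<le> w n * (m - d (Suc n))"
proof (induction n)
  case 0
  then show ?case using w d by simp
next
  case (Suc n)
  have "w n * (m - d (Suc n)) \<le> w (Suc n) * (m - d (Suc n))"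
    using w d by (intro mult_right_mono) auto
  with Suc show ?case by (simp add: algebra_simps)
qed

text \<open>The factor of \<open>d k - d (Suc k)\<close> is the inverse of twice the step size.
  After multiplication by \<open>k\<close> it still increases, so all differences telescope.
  Dividing by n (n + 1) / 2 turns the three sums n sqrt(n + 1) \<open>d\<^sub>m\<close> / (2 c), 2 n
  \<open>e\<^sub>m\<close> and n sqrt(n) times the error into the terms with coefficients 1, 4 and
  2.\<close>

lemma sum_weighted_errors_le:
  fixes u d e \<beta> :: "nat \<Rightarrow> real"
  assumes u: "\<And>k. 1 \<le> k \<Longrightarrow> u k \<le> sqrt (real (Suc k)) / (2 * c) * (d k - d (Suc k)) +
      (e k - e (Suc k)) + (a + m * \<beta> k) / sqrt (real k)"
    and d: "\<And>k. 0 \<le> d k" "\<And>k. d k \<le> d\<^sub>m" and e: "\<And>k. \<bar>e k\<bar> \<le> e\<^sub>m"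
    and \<beta>: "\<And>k. 0 \<le> \<beta> k" "mono \<beta>" and nonneg: "0 \<le> a" "0 \<le> m" "0 < c" and n: "1 \<le> n"
  shows "(\<Sum>k=1..n. real k * u k) / (\<Sum>k=1..n. real k) \<le> (d\<^sub>m / c + 4 * e\<^sub>m + 2 * a + 2 * m * \<beta> n) / sqrt (real n)"
proof -
  let ?a = "a + m * \<beta> n"
  have a: "0 \<le> ?a" using nonneg \<beta>(1)[of n] by simp
  have d0: "0 \<le> d\<^sub>m" using d[of 0] by linarith
  have e0: "0 \<le> e\<^sub>m" using e[of 0] by linarith
  have "(\<Sum>k=1..n. real k * u k) \<le> (\<Sum>k=1..n. real k * sqrt (real (Suc k)) * (d k - d (Suc k)) / (2 * c) +
      real k * (e k - e (Suc k)) + sqrt (real n) * ?a)"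
  proof (rule sum_mono)
    fix k assume k: "k \<in> {1..n}"
    have "real k * u k \<le> real k * (sqrt (real (Suc k)) / (2 * c) * (d k - d (Suc k)) +
        (e k - e (Suc k)) + (a + m * \<beta> k) / sqrt (real k))"
      using k by (intro mult_left_mono u) auto
    also have "real k * ((a + m * \<beta> k) / sqrt (real k)) = sqrt (real k) * (a + m * \<beta> k)"
      using k real_div_sqrt[of "real k"] by (simp add: field_simps)
    then have "real k * (sqrt (real (Suc k)) / (2 * c) * (d k - d (Suc k)) + (e k - e (Suc k)) +
        (a + m * \<beta> k) / sqrt (real k)) = real k * sqrt (real (Suc k)) * (d k - d (Suc k)) / (2 * c) +
        real k * (e k - e (Suc k)) + sqrt (real k) * (a + m * \<beta> k)"
      by (simp add: distrib_left)
    also have "sqrt (real k) * (a + m * \<beta> k) \<le> sqrt (real n) * ?a"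
      using k nonneg \<beta> by (intro mult_mono add_mono mult_left_mono monoD[OF \<beta>(2)]) auto
    finally show "real k * u k \<le> real k * sqrt (real (Suc k)) * (d k - d (Suc k)) / (2 * c) +
      real k * (e k - e (Suc k)) + sqrt (real n) * ?a" by simp
  qed
  also have "\<dots> = (\<Sum>k=1..n. real k * sqrt (real (Suc k)) * (d k - d (Suc k))) / (2 * c) +
      (\<Sum>k=1..n. real k * (e k - e (Suc k))) + real n * (sqrt (real n) * ?a)"
    by (simp add: sum.distrib sum_divide_distrib)
  also have "(\<Sum>k=1..n. real k * sqrt (real (Suc k)) * (d k - d (Suc k))) \<le>
      real n * sqrt (real (Suc n)) * (d\<^sub>m - d (Suc n))"
    by (intro sum_weighted_differences_le d mult_mono) auto
  also have "real n * sqrt (real (Suc n)) * (d\<^sub>m - d (Suc n)) \<le> real n * sqrt (real (Suc n)) * d\<^sub>m"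
    using d by (intro mult_left_mono) auto
  also have "(\<Sum>k=1..n. real k * (e k - e (Suc k))) \<le> real n * (e\<^sub>m - e (Suc n))"
    using e by (intro sum_weighted_differences_le) (auto simp: abs_le_iff)
  also have "real n * (e\<^sub>m - e (Suc n)) \<le> real n * (2 * e\<^sub>m)"
    using e[of "Suc n"] by (intro mult_left_mono) auto
  finally have S: "(\<Sum>k=1..n. real k * u k) \<le> real n * sqrt (real (Suc n)) * d\<^sub>m / (2 * c) +
      real n * (2 * e\<^sub>m) + real n * (sqrt (real n) * ?a)"
    using nonneg by (simp add: divide_right_mono)
  define s where "s = sqrt (real n)"
  have s: "1 \<le> s" "s * s = real n" using n by (auto simp: s_def)
  define t where "t = sqrt (real (Suc n))"
  have t: "s \<le> t" "t * t = real n + 1" by (auto simp: s_def t_def)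
  have sum: "(\<Sum>k=1..n. real k) = real n * (t * t) / 2"
    unfolding t(2) by (induction n) (simp_all add: field_simps)
  have "(\<Sum>k=1..n. real k * u k) / (\<Sum>k=1..n. real k) \<le>
      (real n * t * d\<^sub>m / (2 * c) + real n * (2 * e\<^sub>m) + real n * (s * ?a)) / (real n * (t * t) / 2)"
    unfolding sum by (rule divide_right_mono) (use S in \<open>simp_all add: s_def t_def\<close>)
  also have "\<dots> = d\<^sub>m / c * (1 / t) + 4 * e\<^sub>m * (1 / (t * t)) + 2 * ?a * (s / (t * t))"
  proof -
    have "(N * t * d / (2 * c) + N * (2 * e) + N * (s * A)) / (N * (t * t) / 2) =
        d / c * (1 / t) + 4 * e * (1 / (t * t)) + 2 * A * (s / (t * t))"
      if "N \<noteq> 0" "t \<noteq> 0" "c \<noteq> 0" for N t d c e s A :: real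
      using that by (simp add: field_simps)
    then show ?thesis using n s(1) t(1) nonneg by force
  qed
  also have "\<dots> \<le> d\<^sub>m / c * (1 / s) + 4 * e\<^sub>m * (1 / s) + 2 * ?a * (1 / s)"
  proof -
    have "s \<le> t * t" using s t by (metis add.commute le_add_same_cancel2 mult_left_mono mult_mono order_trans mult.right_neutral zero_le_one)
    moreover have "s * s \<le> t * t" using s t by simp
    ultimately show ?thesis
      using s t a d0 e0 nonneg
      by (intro add_mono mult_left_mono) (auto simp: field_simps)
  qed
  also have "\<dots> = (d\<^sub>m / c + 4 * e\<^sub>m + 2 * a + 2 * m * \<beta> n) / s"
    by (simp add: add_divide_distrib algebra_simps)
  finally show ?thesis by (simp add: s_def)
qed

text \<open>The threshold depends on \<open>a\<close>, the coefficient does not: \<open>a\<close> is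
  eventually below ln n and is paid for by the summand 1. For n \<ge> 3 one has n + 3 \<le> n^2, so
  the logarithm on the left is at most twice the one on the right.\<close>

lemma log_rate_absorbs_constant:
  fixes a m\<^sub>0 \<Delta> C :: real and N :: nat
  assumes "1 \<le> C" "1 \<le> N" "0 < \<Delta>" "0 \<le> m\<^sub>0"
  shows "\<forall>\<^sub>F n in sequentially. (a + 2 * (m\<^sub>0 * C\<^sup>2) * (ln ((real n + 3) * (real N)\<^sup>2) / (2 * \<Delta>))) / sqrt (real n)
    \<le> (2 * m\<^sub>0 / \<Delta> + 1) * ((1 + C\<^sup>2 * ln (real n * real N)) / sqrt (real n))"
proof -
  have "filterlim (\<lambda>n. ln (real n)) at_top sequentially"
    by (rule filterlim_compose[OF ln_at_top filterlim_real_sequentially])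
  then have "\<forall>\<^sub>F n in sequentially. a \<le> ln (real n)"
    by (simp add: filterlim_at_top)
  then show ?thesis
    using eventually_ge_at_top[of 3]
  proof eventually_elim
    case (elim n)
    have C2: "1 \<le> C\<^sup>2" using assms(1) by simp
    have l: "ln (real n) \<le> ln (real n * real N)" "0 \<le> ln (real n)"
      using elim assms(2) by auto
    have "(real n + 3) * (real N)\<^sup>2 \<le> (real n * real N)\<^sup>2"
    proof -
      have "real n + 3 \<le> 3 * real n" using elim by simp
      also have "\<dots> \<le> (real n)\<^sup>2" using elim by (simp add: power2_eq_square)
      finally show ?thesis by (simp add: power_mult_distrib mult_right_mono)
    qed
    then have "ln ((real n + 3) * (real N)\<^sup>2) \<le> ln ((real n * real N)\<^sup>2)"
      using assms(2) elim by (intro ln_mono) auto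
    also have "\<dots> = 2 * ln (real n * real N)"
      using assms(2) elim by (subst ln_realpow) auto
    finally have "ln ((real n + 3) * (real N)\<^sup>2) / (2 * \<Delta>) \<le> ln (real n * real N) / \<Delta>"
      using assms(3) by (simp add: field_simps)
    then have "2 * (m\<^sub>0 * C\<^sup>2) * (ln ((real n + 3) * (real N)\<^sup>2) / (2 * \<Delta>)) \<le>
        2 * (m\<^sub>0 * C\<^sup>2) * (ln (real n * real N) / \<Delta>)"
      using assms(4) by (intro mult_left_mono) auto
    moreover have "a \<le> C\<^sup>2 * ln (real n * real N)"
      using elim(1) l mult_mono[OF C2 l(1)] by auto
    moreover have "0 \<le> 2 * m\<^sub>0 / \<Delta>" using assms by simp
    ultimately have "a + 2 * (m\<^sub>0 * C\<^sup>2) * (ln ((real n + 3) * (real N)\<^sup>2) / (2 * \<Delta>)) \<le>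
        (2 * m\<^sub>0 / \<Delta> + 1) * (1 + C\<^sup>2 * ln (real n * real N))"
      by (simp add: algebra_simps)
    then show ?case by (simp add: divide_right_mono)
  qed
qed

lemma gap_leD:
  assumes "ereal \<Delta> \<le> gap I s" "j \<in> I" "j \<notin> argmax_set I s"
  shows "s j \<le> (MAX i\<in>I. s i) - \<Delta>"
proof -
  have "ereal (s j) \<le> (SUP j\<in>I - argmax_set I s. ereal (s j))"
    using assms(2,3) by (intro SUP_upper) auto
  then have "ereal \<Delta> \<le> ereal (MAX i\<in>I. s i) - ereal (s j)"
    using assms(1) unfolding gap_def by (meson ereal_minus_mono order_refl order_trans)
  then show ?thesis by simp
qed

lemma argmax_setD:
  assumes "finite I" "j \<in> argmax_set I s"
  shows "j \<in> I" "s j = (MAX i\<in>I. s i)"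
proof -
  show "j \<in> I" using assms by (simp add: argmax_set_def is_arg_max_def)
  then show "s j = (MAX i\<in>I. s i)"
    using assms by (intro Max_eqI[symmetric]) (auto simp: argmax_set_def is_arg_max_linorder)
qed

section \<open>Convergence of the method\<close>

text \<open>Linear programming is abstracted to subgradients and two separate bounds:
  \<open>L\<close> for the recourse values alone, \<open>B\<close> for the full step directions.
  \<open>D\<close> bounds the Euclidean diameter.\<close>

locale soft_separation =
  proposal_kernel I q rule +
  index_chain M I J "\<lambda>n js. transition rule I q (2 * \<Delta> / ln ((real n + 2) * (real (card I))\<^sup>2))
    (Q (iterate X (\<lambda>n. c / sqrt (real n)) Z x0 js n))"
  for I :: "'i set" and q rule and M :: "'w measure" and J \<Delta>
    and Q :: "real ^ 'x \<Rightarrow> 'i \<Rightarrow> real" and X :: "(real ^ 'x) set" and c Z x0 +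
  fixes f :: "real ^ 'x \<Rightarrow> real" and N :: "('i \<Rightarrow> real) \<Rightarrow> real" and \<kappa> C L B D :: real
  assumes X: "compact X" "convex X" "x0 \<in> X"
    and diam: "x \<in> X \<Longrightarrow> y \<in> X \<Longrightarrow> norm (x - y) \<le> D"
    and subgrad: "x \<in> X \<Longrightarrow> y \<in> X \<Longrightarrow> i \<in> I \<Longrightarrow> f x + Q x i + Z x i \<bullet> (y - x) \<le> f y + Q y i"
    and Q_lipschitz: "x \<in> X \<Longrightarrow> y \<in> X \<Longrightarrow> i \<in> I \<Longrightarrow> \<bar>Q x i - Q y i\<bar> \<le> L * norm (x - y)"
    and Z_bound: "x \<in> X \<Longrightarrow> i \<in> I \<Longrightarrow> norm (Z x i) \<le> B"
    and c_pos: "0 < c" and \<Delta>_pos: "0 < \<Delta>" and C_pos: "0 < C" and L_nonneg: "0 \<le> L"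
    and norm_N: "norm_on I N" and equiv_N: "max_norm_equivalent \<kappa> I N"
    and fundamental_bound: "x \<in> X \<Longrightarrow> operator_norm I N
      (fundamental_matrix rule I q (2 * \<Delta> / ln ((real n + 2) * (real (card I))\<^sup>2)) (Q x)) \<le> C"
    and gap_bound: "\<forall>\<^sub>F n in sequentially. AE \<omega> in M.
      ereal \<Delta> \<le> gap I (Q (iterate X (\<lambda>n. c / sqrt (real n)) Z x0 (\<lambda>k. J k \<omega>) n))"
begin

abbreviation w where "w n \<equiv> 2 * \<Delta> / ln ((real n + 2) * (real (card I))\<^sup>2)"
abbreviation xpath where "xpath \<equiv> iterate X (\<lambda>n. c / sqrt (real n)) Z x0"
abbreviation iter where "iter n \<omega> \<equiv> xpath (path \<omega>) n"

definition F where "F x = f x + (MAX i\<in>I. Q x i)"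

lemma card_I: "1 \<le> real (card I)"
  using finite_I nonempty_I by (simp add: Suc_le_eq card_gt_0_iff)

lemma log_pos: "0 < ln ((real n + 2) * (real (card I))\<^sup>2)"
proof -
  have "1 * 1 < (real n + 2) * (real (card I))\<^sup>2"
    using card_I by (intro mult_less_le_imp_less) auto
  then show ?thesis by simp
qed

lemma w_pos: "0 < w n"
  using log_pos \<Delta>_pos by simp

text \<open>The inverse temperature 1 / \<open>w n\<close>.\<close>

definition \<beta> where "\<beta> n = ln ((real n + 2) * (real (card I))\<^sup>2) / (2 * \<Delta>)"

lemma \<beta>_pos: "0 < \<beta> n"
  using log_pos \<Delta>_pos by (simp add: \<beta>_def)

lemma \<beta>_mono: "mono \<beta>"
  unfolding \<beta>_def using \<Delta>_pos card_I
  by (intro monoI divide_right_mono ln_mono mult_right_mono) auto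

text \<open>Cooling changes the exponents at rate 1/n, which is of smaller order than the movement
  of the iterates.\<close>

lemma \<beta>_increment: "\<beta> (Suc n) - \<beta> n \<le> 1 / (2 * \<Delta>) / (real n + 2)"
proof -
  have "\<beta> (Suc n) - \<beta> n = ln ((real n + 3) / (real n + 2)) / (2 * \<Delta>)"
    using card_I by (simp add: \<beta>_def ln_mult ln_div diff_divide_distrib[symmetric] add.commute)
  also have "ln ((real n + 3) / (real n + 2)) \<le> (real n + 3) / (real n + 2) - 1"
    by (intro ln_le_minus_one) simp
  also have "(real n + 3) / (real n + 2) - 1 = 1 / (real n + 2)"
    by (simp add: field_simps)
  finally show ?thesis
    using \<Delta>_pos by (simp add: divide_right_mono mult.commute)
qed

lemma xpath_in: "(\<And>k. js k \<in> I) \<Longrightarrow> xpath js n \<in> X"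
  using X closest_point_in_set[of X] by (cases n) (auto simp: compact_imp_closed)

lemma iter_in: "\<omega> \<in> space M \<Longrightarrow> iter n \<omega> \<in> X"
  by (rule xpath_in) (rule J_in)

lemma xpath_adapted: "(\<And>k. k \<le> n \<Longrightarrow> js k = js' k) \<Longrightarrow> xpath js n = xpath js' n"
  by (induction n) simp_all

declare iterate.simps(2) [simp del]

section \<open>Objective, minimizer and centred slack\<close>

lemma D_nonneg: "0 \<le> D"
  using diam[OF X(3) X(3)] by simp

lemma B_nonneg: "0 \<le> B"
  using Z_bound[OF X(3)] nonempty_I norm_ge_zero order_trans by blast

lemma Max_attained:
  obtains i where "i \<in> I" "(MAX i\<in>I. Q x i) = Q x i"
proof -
  have "(MAX i\<in>I. Q x i) \<in> Q x ` I"
    using finite_I nonempty_I by (intro Max_in) auto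
  then show thesis using that by blast
qed

lemma Q_le_Max: "i \<in> I \<Longrightarrow> Q x i \<le> (MAX i\<in>I. Q x i)"
  using finite_I by simp

text \<open>A scenario attaining the maximum at \<open>x\<close> only underestimates it at other
  points. This gives continuity and later takes the place of convexity in Jensen's
  inequality.\<close>

lemma F_subgradient:
  assumes "x \<in> X"
  obtains s where "norm s \<le> B" "\<And>y. y \<in> X \<Longrightarrow> F x + s \<bullet> (y - x) \<le> F y"
proof -
  obtain i where i: "i \<in> I" "(MAX i\<in>I. Q x i) = Q x i" by (rule Max_attained)
  show thesis
  proof (rule that)
    show "norm (Z x i) \<le> B" by (rule Z_bound[OF assms i(1)])
    fix y assume "y \<in> X"
    from subgrad[OF assms this i(1)] Q_le_Max[OF i(1), of y]
    show "F x + Z x i \<bullet> (y - x) \<le> F y" by (simp add: F_def i(2))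
  qed
qed

lemma F_continuous: "continuous_on X F"
proof -
  have *: "F x - F y \<le> B * norm (x - y)" if "x \<in> X" "y \<in> X" for x y
  proof -
    obtain s where s: "norm s \<le> B" "\<And>y. y \<in> X \<Longrightarrow> F x + s \<bullet> (y - x) \<le> F y"
      using F_subgradient[OF \<open>x \<in> X\<close>] by blast
    have "F x - F y \<le> s \<bullet> (x - y)"
      using s(2)[OF \<open>y \<in> X\<close>] by (simp add: inner_diff_right)
    also have "\<dots> \<le> norm s * norm (x - y)" by (rule norm_cauchy_schwarz)
    also have "\<dots> \<le> B * norm (x - y)" using s(1) by (intro mult_right_mono) auto
    finally show ?thesis .
  qed
  have "B-lipschitz_on X F"
  proof (rule lipschitz_onI[OF _ B_nonneg])
    fix x y assume "x \<in> X" "y \<in> X"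
    then show "dist (F x) (F y) \<le> B * dist x y"
      using *[of x y] *[of y x] by (auto simp: dist_norm norm_minus_commute abs_le_iff)
  qed
  then show ?thesis by (rule lipschitz_on_continuous_on)
qed

definition xstar where "xstar = (SOME y. y \<in> X \<and> (\<forall>z\<in>X. F y \<le> F z))"

lemma xstar: "xstar \<in> X" "z \<in> X \<Longrightarrow> F xstar \<le> F z"
proof -
  have "\<exists>y. y \<in> X \<and> (\<forall>z\<in>X. F y \<le> F z)"
    using continuous_attains_inf[OF X(1) _ F_continuous] X(3) by blast
  from someI_ex[OF this] show "xstar \<in> X" "z \<in> X \<Longrightarrow> F xstar \<le> F z"
    unfolding xstar_def by auto
qed

lemma INF_F: "(INF x\<in>X. F x) = F xstar"
  using xstar by (intro cInf_eq_minimum) auto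

definition slack where "slack x i = (MAX j\<in>I. Q x j) - Q x i"

text \<open>Centring the slack at the minimizer bounds it independently of the scenario values.\<close>

definition \<psi> where "\<psi> x i = slack x i - slack xstar i"

lemma slack_nonneg: "i \<in> I \<Longrightarrow> 0 \<le> slack x i"
  by (simp add: slack_def Q_le_Max)

lemma Max_Q_lipschitz:
  assumes "x \<in> X" "y \<in> X"
  shows "\<bar>(MAX i\<in>I. Q x i) - (MAX i\<in>I. Q y i)\<bar> \<le> L * norm (x - y)"
proof -
  have *: "(MAX i\<in>I. Q x i) \<le> (MAX i\<in>I. Q y i) + L * norm (x - y)" if "x \<in> X" "y \<in> X" for x y
  proof -
    obtain i where i: "i \<in> I" "(MAX i\<in>I. Q x i) = Q x i" by (rule Max_attained)
    show ?thesis using Q_lipschitz[OF that i(1)] Q_le_Max[OF i(1), of y] unfolding i(2) by linarith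
  qed
  from *[OF assms] *[OF assms(2,1)] show ?thesis by (simp add: norm_minus_commute abs_le_iff)
qed

lemma \<psi>_lipschitz:
  assumes "x \<in> X" "y \<in> X" "i \<in> I"
  shows "\<bar>\<psi> x i - \<psi> y i\<bar> \<le> 2 * L * norm (x - y)"
  using Max_Q_lipschitz[OF assms(1,2)] Q_lipschitz[OF assms] unfolding \<psi>_def slack_def by linarith

lemma \<psi>_bound:
  assumes "x \<in> X" "i \<in> I"
  shows "\<bar>\<psi> x i\<bar> \<le> 2 * L * D"
proof -
  have "\<psi> xstar i = 0" by (simp add: \<psi>_def)
  then have "\<bar>\<psi> x i\<bar> \<le> 2 * L * norm (x - xstar)"
    using \<psi>_lipschitz[OF assms(1) xstar(1) assms(2)] by simp
  also have "\<dots> \<le> 2 * L * D"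
    using diam[OF assms(1) xstar(1)] L_nonneg by (intro mult_left_mono) auto
  finally show ?thesis .
qed

definition R where "R = \<kappa> * C"

lemma C_ge_1: "1 \<le> C"
  using fundamental_matrix_norm_ge_1[OF norm_N equiv_N] fundamental_bound[OF X(3)] order_trans by blast

lemma R_ge_1: "1 \<le> R"
proof -
  have "1 \<le> \<kappa>"
    using max_norm_equivalentE[OF finite_I nonempty_I equiv_N] by blast
  then show ?thesis
    unfolding R_def using C_ge_1 mult_mono[of 1 \<kappa> 1 C] by simp
qed

lemma stable:
  assumes "x \<in> X" "\<And>i. i \<in> I \<Longrightarrow> \<bar>\<Sum>j\<in>I. poisson (w n) (Q x) i j * v j\<bar> \<le> t" "i \<in> I"
  shows "\<bar>v i\<bar> \<le> R * t"
  unfolding R_def using C_pos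
  by (intro poisson_stable[OF norm_N equiv_N fundamental_bound[OF assms(1)] _ assms(2,3)]) auto

definition \<nu> where "\<nu> n x = (SOME v. \<forall>i\<in>I. (\<Sum>j\<in>I. poisson (w n) (Q x) i j * v j) = \<psi> x i)"

lemma \<nu>_poisson:
  assumes "i \<in> I"
  shows "(\<Sum>j\<in>I. poisson (w n) (Q x) i j * \<nu> n x j) = \<psi> x i"
proof -
  obtain v where "\<And>i. i \<in> I \<Longrightarrow> (\<Sum>j\<in>I. poisson (w n) (Q x) i j * v j) = \<psi> x i"
    using poisson_solution[of "w n" "Q x" "\<psi> x"] by blast
  then have "\<exists>v. \<forall>i\<in>I. (\<Sum>j\<in>I. poisson (w n) (Q x) i j * v j) = \<psi> x i" by blast
  from someI_ex[OF this] show ?thesis unfolding \<nu>_def using assms by blast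
qed

text \<open>The conditional mean of \<open>\<nu> n x\<close> at the next index given the present
  one; it is the quantity that telescopes in time.\<close>

definition \<eta> where "\<eta> n x i = (\<Sum>j\<in>I. P (w n) (Q x) i j * \<nu> n x j)"
definition bias where "bias n x = (\<Sum>j\<in>I. p (w n) (Q x) j * \<psi> x j)"

lemma \<psi>_decomposition:
  assumes "i \<in> I"
  shows "\<psi> x i = bias n x + (\<nu> n x i - \<eta> n x i)"
proof -
  have "bias n x = (\<Sum>j\<in>I. p (w n) (Q x) j * \<nu> n x j)"
    using gibbs_poisson_apply[of "w n" "Q x" "\<nu> n x"] by (simp add: bias_def \<nu>_poisson)
  then show ?thesis
    using \<nu>_poisson[OF assms, of n x] by (simp add: poisson_apply[OF assms] \<eta>_def)
qed

lemma \<eta>_bound: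
  assumes "x \<in> X" "i \<in> I"
  shows "\<bar>\<eta> n x i\<bar> \<le> R * (2 * L * D)"
proof -
  have \<nu>: "\<bar>\<nu> n x j\<bar> \<le> R * (2 * L * D)" if "j \<in> I" for j
    by (rule stable[OF assms(1) _ that, of n]) (simp add: \<nu>_poisson \<psi>_bound assms(1))
  have "\<bar>\<eta> n x i\<bar> \<le> (\<Sum>j\<in>I. P (w n) (Q x) i j * (R * (2 * L * D)))"
    unfolding \<eta>_def
    by (rule order_trans[OF sum_abs])
      (auto simp: abs_mult transition_pos[OF assms(2)] intro!: sum_mono mult_mono \<nu> transition_pos[OF assms(2), THEN less_imp_le])
  then show ?thesis
    using transition_sum[OF assms(2)] by (simp flip: sum_distrib_right)
qed

text \<open>This depends on the scenarios, so it may occur only in terms without the logarithm: the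
  Gibbs bias and the effect of cooling.\<close>

definition Qmax where "Qmax = (MAX i\<in>I. \<bar>Q x0 i\<bar>) + L * D"

lemma Q_bound:
  assumes "x \<in> X" "i \<in> I"
  shows "\<bar>Q x i\<bar> \<le> Qmax"
proof -
  have "\<bar>Q x0 i\<bar> \<le> (MAX i\<in>I. \<bar>Q x0 i\<bar>)" using assms finite_I by auto
  moreover have "\<bar>Q x i - Q x0 i\<bar> \<le> L * norm (x - x0)" by (rule Q_lipschitz[OF assms(1) X(3) assms(2)])
  moreover have "L * norm (x - x0) \<le> L * D"
    using diam[OF assms(1) X(3)] L_nonneg by (intro mult_left_mono) auto
  ultimately show ?thesis unfolding Qmax_def by linarith
qed

lemma Qmax_nonneg: "0 \<le> Qmax"
  using Q_bound[OF X(3)] nonempty_I abs_ge_zero order_trans by blast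

lemma \<eta>_drift:
  assumes x: "x \<in> X" "x' \<in> X" and i: "i \<in> I"
  shows "\<bar>\<eta> (Suc n) x' i - \<eta> n x i\<bar> \<le> R * (2 * L * norm (x' - x)) +
    12 * R\<^sup>2 * (\<beta> (Suc n) * (L * norm (x' - x)) + (\<beta> (Suc n) - \<beta> n) * Qmax) * (2 * L * D)"
  unfolding \<eta>_def
proof (rule poisson_solution_perturbation[where y = "\<psi> x" and y' = "\<psi> x'"])
  fix j assume j: "j \<in> I"
  \<comment> \<open>Movement of the iterate is measured at the new temperature, cooling at the old
    scores.\<close>
  have "Q x j / w n - Q x' j / w (Suc n) = \<beta> (Suc n) * (Q x j - Q x' j) - (\<beta> (Suc n) - \<beta> n) * Q x j"
  proof -
    have "a / w m = \<beta> m * a" for a m by (simp add: \<beta>_def)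
    then show ?thesis by (simp only: algebra_simps)
  qed
  also have "\<bar>\<dots>\<bar> \<le> \<beta> (Suc n) * \<bar>Q x j - Q x' j\<bar> + (\<beta> (Suc n) - \<beta> n) * \<bar>Q x j\<bar>"
    using \<beta>_pos[of "Suc n"] monoD[OF \<beta>_mono, of n "Suc n"]
    by (intro order_trans[OF abs_triangle_ineq4]) (simp add: abs_mult)
  also have "\<dots> \<le> \<beta> (Suc n) * (L * norm (x' - x)) + (\<beta> (Suc n) - \<beta> n) * Qmax"
    using \<beta>_pos[of "Suc n"] monoD[OF \<beta>_mono, of n "Suc n"] Q_lipschitz[OF x j] Q_bound[OF x(1) j]
    by (intro add_mono mult_left_mono) (auto simp: norm_minus_commute)
  finally show "\<bar>Q x j / w n - Q x' j / w (Suc n)\<bar> \<le>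
    \<beta> (Suc n) * (L * norm (x' - x)) + (\<beta> (Suc n) - \<beta> n) * Qmax" .
  show "\<bar>\<psi> x j\<bar> \<le> 2 * L * D" by (rule \<psi>_bound[OF x(1) j])
  show "\<bar>\<psi> x' j - \<psi> x j\<bar> \<le> 2 * L * norm (x' - x)" by (rule \<psi>_lipschitz[OF x(2,1) j])
next
  show "1 \<le> R" by (rule R_ge_1)
  show "i \<in> I" by (rule i)
  show "(\<Sum>l\<in>I. poisson (w n) (Q x) j l * \<nu> n x l) = \<psi> x j" if "j \<in> I" for j
    by (rule \<nu>_poisson[OF that])
  show "(\<Sum>l\<in>I. poisson (w (Suc n)) (Q x') j l * \<nu> (Suc n) x' l) = \<psi> x' j" if "j \<in> I" for j
    by (rule \<nu>_poisson[OF that])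
  show "\<bar>v j\<bar> \<le> R * t"
    if "\<And>k. k \<in> I \<Longrightarrow> \<bar>\<Sum>l\<in>I. poisson (w n) (Q x) k l * v l\<bar> \<le> t" "j \<in> I" for v t j
    by (rule stable[OF x(1) that])
  show "\<bar>v j\<bar> \<le> R * t"
    if "\<And>k. k \<in> I \<Longrightarrow> \<bar>\<Sum>l\<in>I. poisson (w (Suc n)) (Q x') k l * v l\<bar> \<le> t" "j \<in> I" for v t j
    by (rule stable[OF x(2) that])
qed

section \<open>The Gibbs mean of the slack\<close>

lemma slack_le: "x \<in> X \<Longrightarrow> i \<in> I \<Longrightarrow> slack x i \<le> 2 * Qmax"
  using Max_attained[of x] Q_bound[of x i] Q_bound[of x]
  unfolding slack_def by (smt (verit))

text \<open>Centring does no harm here, as the nonnegative slack at the minimizer enters with a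
  minus sign.\<close>

lemma bias_le_slack: "bias n x \<le> (\<Sum>j\<in>I. p (w n) (Q x) j * slack x j)"
  unfolding bias_def using slack_nonneg[of _ xstar] gibbs_pos
  by (intro sum_mono mult_left_mono) (auto simp: \<psi>_def less_imp_le)

lemma bias_le:
  assumes "x \<in> X"
  shows "bias n x \<le> 2 * Qmax"
proof -
  have "(\<Sum>j\<in>I. p (w n) (Q x) j * slack x j) \<le> (\<Sum>j\<in>I. p (w n) (Q x) j * (2 * Qmax))"
    using slack_le[OF assms] gibbs_pos by (intro sum_mono mult_left_mono) (auto simp: less_imp_le)
  then show ?thesis
    using bias_le_slack[of n x] by (simp add: gibbs_sum flip: sum_distrib_right)
qed

text \<open>The temperature is chosen such that exp (- \<Delta> / w n) = 1 / (sqrt (n + 2) * card I).\<close>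

lemma bias_le_of_gap:
  assumes x: "x \<in> X" and gap: "ereal \<Delta> \<le> gap I (Q x)"
  shows "bias n x \<le> 2 * Qmax / sqrt (real n + 2)"
proof -
  have e: "exp (- \<Delta> / w n) = 1 / (sqrt (real n + 2) * real (card I))"
  proof -
    have "- \<Delta> / w n = - ln ((real n + 2) * (real (card I))\<^sup>2) / 2"
      using \<Delta>_pos log_pos[of n] by (simp add: field_simps)
    also have "\<dots> = - ln (sqrt ((real n + 2) * (real (card I))\<^sup>2))"
      using card_I by (subst ln_sqrt) auto
    also have "exp \<dots> = 1 / sqrt ((real n + 2) * (real (card I))\<^sup>2)"
      using card_I by (simp add: exp_minus inverse_eq_divide)
    finally show ?thesis by (simp add: real_sqrt_mult)
  qed
  \<comment> \<open>Maximizers have no slack, other indices little mass; the factor 1 /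
    \<open>card I\<close> compensates for the number of terms.\<close>
  have "p (w n) (Q x) j * slack x j \<le> 1 / (sqrt (real n + 2) * real (card I)) * (2 * Qmax)" if j: "j \<in> I" for j
  proof (cases "j \<in> argmax_set I (Q x)")
    case True
    then have "slack x j = 0"
      using argmax_setD[OF finite_I True] by (simp add: slack_def)
    then show ?thesis using Qmax_nonneg by simp
  next
    case False
    obtain m where m: "m \<in> I" "(MAX i\<in>I. Q x i) = Q x m" by (rule Max_attained)
    have "p (w n) (Q x) j \<le> exp (- \<Delta> / w n)"
      using gap_leD[OF gap j False] m(2) by (intro gibbs_mass_of_gap[OF j _ m(1) _ w_pos]) auto
    then show ?thesis
      unfolding e using slack_le[OF x j] slack_nonneg[OF j] by (intro mult_mono) auto
  qed
  then have "bias n x \<le> (\<Sum>j\<in>I. 1 / (sqrt (real n + 2) * real (card I)) * (2 * Qmax))"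
    by (intro order_trans[OF bias_le_slack] sum_mono)
  then show ?thesis using card_I by (simp add: field_simps)
qed

section \<open>Expected one-step estimates along the iterates\<close>

lemma adapted_iterate: "k \<le> n \<Longrightarrow> adapted n (\<lambda>js. H (xpath js k))"
  unfolding adapted_def by (metis xpath_adapted order_trans)

lemma adapted_iterate_index: "k \<le> n \<Longrightarrow> l \<le> n \<Longrightarrow> adapted n (\<lambda>js. H (xpath js k) (js l))"
  unfolding adapted_def by (metis xpath_adapted order_trans)

lemma integrable_iter: "integrable M (\<lambda>\<omega>. H (iter k \<omega>) :: real)"
  by (rule integrable_adapted[OF adapted_iterate[OF order_refl]])

lemma integrable_iter_index: "integrable M (\<lambda>\<omega>. H (iter k \<omega>) (J l \<omega>) :: real)"
  by (rule integrable_adapted[OF adapted_iterate_index[of k "max k l" l H]]) auto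

text \<open>The transition law enters the analysis only here, as the vanishing mean of a martingale
  difference.\<close>

lemma expectation_\<nu>:
  "expectation (\<lambda>\<omega>. \<nu> n (iter n \<omega>) (J (Suc n) \<omega>)) = expectation (\<lambda>\<omega>. \<eta> n (iter n \<omega>) (J n \<omega>))"
  unfolding \<eta>_def
  by (rule expectation_step[where H = "\<lambda>js. \<nu> n (xpath js n)"]) (rule adapted_iterate[OF order_refl])+

lemma iter_step:
  assumes "\<omega> \<in> space M"
  shows "norm (iter (Suc n) \<omega> - iter n \<omega>) \<le> c / sqrt (real (Suc n)) * B"
proof -
  let ?x = "iter n \<omega>" and ?z = "(c / sqrt (real (Suc n))) *\<^sub>R Z (iter n \<omega>) (J (Suc n) \<omega>)"
  have "dist (closest_point X (?x - ?z)) (closest_point X ?x) \<le> dist (?x - ?z) ?x"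
    using X by (intro closest_point_lipschitz) (auto simp: compact_imp_closed)
  moreover have "closest_point X ?x = ?x"
    using iter_in[OF assms] by (rule closest_point_self)
  ultimately have "norm (iter (Suc n) \<omega> - iter n \<omega>) \<le> norm ?z"
    by (simp add: dist_norm iterate.simps(2))
  also have "\<dots> \<le> c / sqrt (real (Suc n)) * B"
    using c_pos Z_bound[OF iter_in[OF assms] J_in[OF assms]] by (simp add: divide_simps mult_left_mono)
  finally show ?thesis .
qed

lemma subgradient_step:
  assumes \<omega>: "\<omega> \<in> space M"
  shows "F (iter n \<omega>) - F xstar \<le>
    sqrt (real (Suc n)) / (2 * c) * ((norm (iter n \<omega> - xstar))\<^sup>2 - (norm (iter (Suc n) \<omega> - xstar))\<^sup>2) +
    c * B\<^sup>2 / 2 / sqrt (real (Suc n)) + \<psi> (iter n \<omega>) (J (Suc n) \<omega>)"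
proof -
  let ?x = "iter n \<omega>" and ?i = "J (Suc n) \<omega>"
  define a where "a = c / sqrt (real (Suc n))"
  have a: "0 < a" using c_pos by (simp add: a_def)
  have x: "?x \<in> X" and i: "?i \<in> I" using iter_in[OF \<omega>] J_in[OF \<omega>] by auto
  have "dist (closest_point X (?x - a *\<^sub>R Z ?x ?i)) (closest_point X xstar) \<le> dist (?x - a *\<^sub>R Z ?x ?i) xstar"
    using X by (intro closest_point_lipschitz) (auto simp: compact_imp_closed)
  then have "norm (iter (Suc n) \<omega> - xstar) \<le> norm ((?x - xstar) - a *\<^sub>R Z ?x ?i)"
    using closest_point_self[OF xstar(1)] by (simp add: dist_norm a_def algebra_simps iterate.simps(2))
  then have "(norm (iter (Suc n) \<omega> - xstar))\<^sup>2 \<le> (norm ((?x - xstar) - a *\<^sub>R Z ?x ?i))\<^sup>2"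
    by (intro power_mono) auto
  also have "\<dots> = (norm (?x - xstar))\<^sup>2 - 2 * a * (Z ?x ?i \<bullet> (?x - xstar)) + a\<^sup>2 * (norm (Z ?x ?i))\<^sup>2"
  proof -
    have "(norm (v - a *\<^sub>R z))\<^sup>2 = (norm v)\<^sup>2 - 2 * a * (z \<bullet> v) + a\<^sup>2 * (norm z)\<^sup>2" for v z :: "real ^ 'x"
      unfolding power2_norm_eq_inner
      by (simp add: inner_diff inner_commute power2_eq_square algebra_simps)
    then show ?thesis by blast
  qed
  also have "a\<^sup>2 * (norm (Z ?x ?i))\<^sup>2 \<le> a\<^sup>2 * B\<^sup>2"
    using Z_bound[OF x i] by (intro mult_left_mono power_mono) auto
  finally have 1: "2 * a * (Z ?x ?i \<bullet> (?x - xstar)) \<le>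
      (norm (?x - xstar))\<^sup>2 - (norm (iter (Suc n) \<omega> - xstar))\<^sup>2 + a\<^sup>2 * B\<^sup>2" by simp
  have "F ?x - F xstar - \<psi> ?x ?i \<le> Z ?x ?i \<bullet> (?x - xstar)"
    using subgrad[OF x xstar(1) i] by (simp add: F_def \<psi>_def slack_def inner_diff_right)
  then have "2 * a * (F ?x - F xstar - \<psi> ?x ?i) \<le> 2 * a * (Z ?x ?i \<bullet> (?x - xstar))"
    using a by (intro mult_left_mono) auto
  moreover have "2 * a * (F ?x - F xstar - \<psi> ?x ?i) = (F ?x - F xstar - \<psi> ?x ?i) * (2 * a)"
    by (rule mult.commute)
  ultimately have "(F ?x - F xstar - \<psi> ?x ?i) * (2 * a) \<le>
      (norm (?x - xstar))\<^sup>2 - (norm (iter (Suc n) \<omega> - xstar))\<^sup>2 + a\<^sup>2 * B\<^sup>2"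
    using 1 by linarith
  then have "F ?x - F xstar - \<psi> ?x ?i \<le>
      ((norm (?x - xstar))\<^sup>2 - (norm (iter (Suc n) \<omega> - xstar))\<^sup>2 + a\<^sup>2 * B\<^sup>2) / (2 * a)"
    using a by (intro mult_imp_le_div_pos) simp_all
  also have "\<dots> = ((norm (?x - xstar))\<^sup>2 - (norm (iter (Suc n) \<omega> - xstar))\<^sup>2) / (2 * a) + a * B\<^sup>2 / 2"
    using a by (simp add: add_divide_distrib power2_eq_square)
  finally show ?thesis by (simp add: a_def ac_simps)
qed

text \<open>The Poisson equation splits the centred slack into the bias of the Gibbs mean, a martingale
  difference and a telescoping term, up to the drift of the kernel.\<close>

lemma expectation_\<psi>:
  "expectation (\<lambda>\<omega>. \<psi> (iter n \<omega>) (J (Suc n) \<omega>)) =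
     expectation (\<lambda>\<omega>. bias n (iter n \<omega>)) + (expectation (\<lambda>\<omega>. \<eta> n (iter n \<omega>) (J n \<omega>)) -
       expectation (\<lambda>\<omega>. \<eta> n (iter n \<omega>) (J (Suc n) \<omega>)))"
proof -
  have "expectation (\<lambda>\<omega>. \<psi> (iter n \<omega>) (J (Suc n) \<omega>)) = expectation (\<lambda>\<omega>. bias n (iter n \<omega>) +
      (\<nu> n (iter n \<omega>) (J (Suc n) \<omega>) - \<eta> n (iter n \<omega>) (J (Suc n) \<omega>)))"
    by (intro Bochner_Integration.integral_cong refl \<psi>_decomposition J_in)
  then show ?thesis
    by (simp add: integrable_iter integrable_iter_index expectation_\<nu>)
qed

text \<open>Before time \<open>n0\<close> only the crude bound \<open>2 * Qmax\<close> is available;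
  the factor \<open>sqrt (real (Suc n0))\<close> makes one constant cover these finitely many
  times.\<close>

lemma expectation_bias_le:
  obtains b where "0 \<le> b" "\<And>n. 1 \<le> n \<Longrightarrow> expectation (\<lambda>\<omega>. bias n (iter n \<omega>)) \<le> b / sqrt (real n)"
proof -
  obtain n0 where n0: "\<And>n. n0 \<le> n \<Longrightarrow> AE \<omega> in M. ereal \<Delta> \<le> gap I (Q (iter n \<omega>))"
    using gap_bound unfolding eventually_sequentially by blast
  let ?E = "\<lambda>n. expectation (\<lambda>\<omega>. bias n (iter n \<omega>))"
  show thesis
  proof (rule that)
    show "0 \<le> 2 * Qmax * sqrt (real (Suc n0))" using Qmax_nonneg by simp
    fix n :: nat assume n: "1 \<le> n"
    show "?E n \<le> 2 * Qmax * sqrt (real (Suc n0)) / sqrt (real n)"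
    proof (cases "n0 \<le> n")
      case True
      have "AE \<omega> in M. bias n (iter n \<omega>) \<le> 2 * Qmax / sqrt (real n + 2)"
        using n0[OF True] AE_space by eventually_elim (rule bias_le_of_gap[OF iter_in])
      then have "?E n \<le> expectation (\<lambda>\<omega>. 2 * Qmax / sqrt (real n + 2))"
        by (intro integral_mono_AE integrable_iter) auto
      also have "\<dots> = 2 * Qmax * 1 / sqrt (real n + 2)" by (simp add: prob_space)
      also have "\<dots> \<le> 2 * Qmax * sqrt (real (Suc n0)) / sqrt (real n)"
        using n Qmax_nonneg by (intro frac_le mult_left_mono) auto
      finally show ?thesis .
    next
      case False
      have "?E n \<le> expectation (\<lambda>\<omega>. 2 * Qmax)"
        by (intro integral_mono integrable_iter) (auto intro: bias_le iter_in)
      also have "\<dots> = 2 * Qmax * 1" by (simp add: prob_space)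
      also have "\<dots> \<le> 2 * Qmax * (sqrt (real (Suc n0)) / sqrt (real n))"
        using n False Qmax_nonneg by (intro mult_left_mono) auto
      finally show ?thesis by simp
    qed
  qed
qed

text \<open>The summands stem from the change of \<open>\<psi>\<close>, from cooling (12 times 2
  from the bound on \<open>\<psi>\<close>, halved by the rate of \<open>\<beta>\<close>) and from
  the movement of the scores (12 times 2). Only the last carries \<open>\<beta>\<close>.\<close>

lemma expectation_drift:
  assumes n: "1 \<le> n"
  shows "expectation (\<lambda>\<omega>. \<eta> (Suc n) (iter (Suc n) \<omega>) (J (Suc n) \<omega>)) -
      expectation (\<lambda>\<omega>. \<eta> n (iter n \<omega>) (J (Suc n) \<omega>))
    \<le> (2 * R * L * c * B + 12 * R\<^sup>2 * Qmax * L * D / \<Delta> + 24 * R\<^sup>2 * L\<^sup>2 * D * c * B * \<beta> (Suc n)) / sqrt (real n)"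
  (is "_ \<le> ?r")
proof -
  have root: "1 / sqrt (real (Suc n)) \<le> 1 / sqrt (real n)" "1 / (real n + 2) \<le> 1 / sqrt (real n)"
  proof -
    show "1 / sqrt (real (Suc n)) \<le> 1 / sqrt (real n)" using n by (intro divide_left_mono) auto
    have "sqrt (real n) \<le> real n" using n by (intro real_le_lsqrt) (auto simp: power2_eq_square)
    then show "1 / (real n + 2) \<le> 1 / sqrt (real n)" using n by (intro divide_left_mono) auto
  qed
  have pos: "0 \<le> R" "0 \<le> 12 * R\<^sup>2" "0 \<le> 2 * L * D"
    using R_ge_1 L_nonneg D_nonneg by auto
  have step: "norm (iter (Suc n) \<omega> - iter n \<omega>) \<le> c * B * (1 / sqrt (real n))" if "\<omega> \<in> space M" for \<omega>
  proof -
    have "c / sqrt (real (Suc n)) * B = c * B * (1 / sqrt (real (Suc n)))" by simp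
    also have "\<dots> \<le> c * B * (1 / sqrt (real n))"
      using root(1) c_pos B_nonneg by (intro mult_left_mono) auto
    finally show ?thesis using iter_step[OF that, of n] by linarith
  qed
  have incr: "\<beta> (Suc n) - \<beta> n \<le> 1 / (2 * \<Delta>) * (1 / sqrt (real n))"
  proof -
    have "1 / (2 * \<Delta>) * (1 / (real n + 2)) \<le> 1 / (2 * \<Delta>) * (1 / sqrt (real n))"
      using root(2) \<Delta>_pos by (intro mult_left_mono) auto
    then show ?thesis using \<beta>_increment[of n] by simp
  qed
  have "\<eta> (Suc n) (iter (Suc n) \<omega>) (J (Suc n) \<omega>) - \<eta> n (iter n \<omega>) (J (Suc n) \<omega>) \<le> ?r"
    if \<omega>: "\<omega> \<in> space M" for \<omega>
  proof -
    let ?d = "norm (iter (Suc n) \<omega> - iter n \<omega>)" and ?s = "1 / sqrt (real n)"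
    have "\<eta> (Suc n) (iter (Suc n) \<omega>) (J (Suc n) \<omega>) - \<eta> n (iter n \<omega>) (J (Suc n) \<omega>) \<le>
        R * (2 * L * ?d) + 12 * R\<^sup>2 * (\<beta> (Suc n) * (L * ?d) + (\<beta> (Suc n) - \<beta> n) * Qmax) * (2 * L * D)"
      using \<eta>_drift[OF iter_in[OF \<omega>, of n] iter_in[OF \<omega>, of "Suc n"] J_in[OF \<omega>, of "Suc n"], of n]
      by linarith
    also have "\<dots> \<le> R * (2 * L * (c * B * ?s)) +
        12 * R\<^sup>2 * (\<beta> (Suc n) * (L * (c * B * ?s)) + 1 / (2 * \<Delta>) * ?s * Qmax) * (2 * L * D)"
      using step[OF \<omega>] incr pos L_nonneg Qmax_nonneg \<beta>_pos[of "Suc n"]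
      by (intro add_mono mult_left_mono mult_right_mono) auto
    also have "\<dots> = ?r"
      using \<Delta>_pos n by (simp add: field_simps power2_eq_square)
    finally show ?thesis .
  qed
  then have "expectation (\<lambda>\<omega>. \<eta> (Suc n) (iter (Suc n) \<omega>) (J (Suc n) \<omega>) - \<eta> n (iter n \<omega>) (J (Suc n) \<omega>))
      \<le> expectation (\<lambda>\<omega>. ?r)"
    by (intro integral_mono Bochner_Integration.integrable_diff integrable_iter_index) auto
  then show ?thesis
    by (simp add: integrable_iter_index prob_space)
qed

lemma linear_average_in:
  assumes "1 \<le> n" "\<And>k. z k \<in> X"
  shows "linear_average z n \<in> X"
proof -
  let ?S = "\<Sum>k=1..n. real k"
  have S: "0 < ?S" using assms(1) by (intro sum_pos) auto
  have "(\<Sum>k=1..n. (real k / ?S) *\<^sub>R z k) \<in> X"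
    using S assms by (intro convex_sum X(2)) (auto simp flip: sum_divide_distrib)
  then show ?thesis
    by (simp add: linear_average_def scaleR_sum_right)
qed

text \<open>Jensen's inequality: with a subgradient taken at the average, the linear terms cancel in
  the weighted sum.\<close>

lemma F_linear_average_le:
  assumes n: "1 \<le> n" and z: "\<And>k. z k \<in> X"
  shows "F (linear_average z n) \<le> (\<Sum>k=1..n. real k * F (z k)) / (\<Sum>k=1..n. real k)"
proof -
  let ?S = "\<Sum>k=1..n. real k" and ?y = "linear_average z n"
  have S: "0 < ?S" using n by (intro sum_pos) auto
  obtain s where s: "\<And>y. y \<in> X \<Longrightarrow> F ?y + s \<bullet> (y - ?y) \<le> F y"
    using F_subgradient[OF linear_average_in[of n z, OF assms]] by blast
  have "?S *\<^sub>R ?y = (\<Sum>k=1..n. real k *\<^sub>R z k)"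
    using S by (simp add: linear_average_def)
  then have "(\<Sum>k=1..n. real k *\<^sub>R (z k - ?y)) = 0"
    by (simp add: scaleR_diff_right sum_subtractf scaleR_sum_left)
  then have "(\<Sum>k=1..n. real k * (s \<bullet> (z k - ?y))) = 0"
    by (metis (no_types, lifting) inner_scaleR_right inner_sum_right inner_zero_right sum.cong)
  then have "?S * F ?y = (\<Sum>k=1..n. real k * (F ?y + s \<bullet> (z k - ?y)))"
    by (simp add: distrib_left sum.distrib flip: sum_distrib_right)
  also have "\<dots> \<le> (\<Sum>k=1..n. real k * F (z k))"
    by (intro sum_mono mult_left_mono s z) simp
  finally show ?thesis using S by (simp add: pos_le_divide_eq mult.commute)
qed

abbreviation xbar where "xbar n \<omega> \<equiv> linear_average (\<lambda>k. iter k \<omega>) n"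

lemma integrable_F_xbar: "integrable M (\<lambda>\<omega>. F (xbar n \<omega>))"
proof -
  have "adapted n (\<lambda>js. F (linear_average (\<lambda>k. xpath js k) n))"
    unfolding adapted_def
  proof (intro allI impI)
    fix js js' :: "nat \<Rightarrow> 'i" assume *: "\<forall>k\<le>n. js k = js' k"
    have "xpath js k = xpath js' k" if "k \<in> {1..n}" for k
      using * that by (intro xpath_adapted) auto
    then show "F (linear_average (\<lambda>k. xpath js k) n) = F (linear_average (\<lambda>k. xpath js' k) n)"
      by (simp add: linear_average_def)
  qed
  from integrable_adapted[OF this] show ?thesis .
qed

lemma expectation_gap_nonneg:
  assumes "1 \<le> n"
  shows "0 \<le> expectation (\<lambda>\<omega>. F (xbar n \<omega>)) - (INF x\<in>X. F x)"
proof -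
  have "expectation (\<lambda>\<omega>. F xstar) \<le> expectation (\<lambda>\<omega>. F (xbar n \<omega>))"
    using assms by (intro integral_mono integrable_F_xbar) (auto intro!: xstar linear_average_in iter_in)
  then show ?thesis by (simp add: INF_F prob_space)
qed

text \<open>The 48 is the 24 of the drift, doubled by the normalization of the linear
  average.\<close>

lemma convergence_rate:
  "\<forall>\<^sub>F n in sequentially. expectation (\<lambda>\<omega>. F (xbar n \<omega>)) - (INF x\<in>X. F x) \<le>
    (48 * \<kappa>\<^sup>2 * L\<^sup>2 * D * c * B / \<Delta> + 1) * ((1 + C\<^sup>2 * ln (real n * real (card I))) / sqrt (real n))"
proof -
  obtain b where b: "0 \<le> b" "\<And>n. 1 \<le> n \<Longrightarrow> expectation (\<lambda>\<omega>. bias n (iter n \<omega>)) \<le> b / sqrt (real n)"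
    using expectation_bias_le by blast
  define u where "u n = expectation (\<lambda>\<omega>. F (iter n \<omega>)) - F xstar" for n
  define d where "d n = expectation (\<lambda>\<omega>. (norm (iter n \<omega> - xstar))\<^sup>2)" for n
  define e where "e n = expectation (\<lambda>\<omega>. \<eta> n (iter n \<omega>) (J n \<omega>))" for n
  \<comment> \<open>\<open>a\<close> collects all that may depend on the instance;
    \<open>m\<^sub>0\<close> is the coefficient of the logarithm with \<open>C\<^sup>2\<close> split
    off.\<close>
  define a where "a = c * B\<^sup>2 / 2 + b + 2 * R * L * c * B + 12 * R\<^sup>2 * Qmax * L * D / \<Delta>"
  define m\<^sub>0 where "m\<^sub>0 = 24 * \<kappa>\<^sup>2 * L\<^sup>2 * D * c * B"
  have m: "24 * R\<^sup>2 * L\<^sup>2 * D * c * B = m\<^sub>0 * C\<^sup>2"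
    by (simp add: m\<^sub>0_def R_def power_mult_distrib ac_simps)
  have m0: "0 \<le> m\<^sub>0"
    using c_pos B_nonneg D_nonneg by (simp add: m\<^sub>0_def)
  \<comment> \<open>The drift is measured at the temperature of the next iteration, whence
    \<open>\<beta> (Suc n)\<close> and n + 3 inside the logarithm.\<close>
  have u: "u n \<le> sqrt (real (Suc n)) / (2 * c) * (d n - d (Suc n)) + (e n - e (Suc n)) +
      (a + m\<^sub>0 * C\<^sup>2 * \<beta> (Suc n)) / sqrt (real n)" if n: "1 \<le> n" for n
  proof -
    have "expectation (\<lambda>\<omega>. F (iter n \<omega>) - F xstar) \<le> expectation (\<lambda>\<omega>.
        sqrt (real (Suc n)) / (2 * c) * ((norm (iter n \<omega> - xstar))\<^sup>2 - (norm (iter (Suc n) \<omega> - xstar))\<^sup>2) +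
        c * B\<^sup>2 / 2 / sqrt (real (Suc n)) + \<psi> (iter n \<omega>) (J (Suc n) \<omega>))"
      by (intro integral_mono Bochner_Integration.integrable_add Bochner_Integration.integrable_diff
          integrable_mult_right integrable_iter integrable_iter[of "\<lambda>x. (norm (x - xstar))\<^sup>2"]
          integrable_iter_index integrable_const subgradient_step)
    then have "u n \<le> sqrt (real (Suc n)) / (2 * c) * (d n - d (Suc n)) + c * B\<^sup>2 / 2 / sqrt (real (Suc n)) +
        expectation (\<lambda>\<omega>. \<psi> (iter n \<omega>) (J (Suc n) \<omega>))"
      unfolding u_def d_def
      by (simp add: integrable_iter integrable_iter[of "\<lambda>x. (norm (x - xstar))\<^sup>2"] integrable_iter_index prob_space)
    moreover have "c * B\<^sup>2 / 2 / sqrt (real (Suc n)) \<le> c * B\<^sup>2 / 2 / sqrt (real n)"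
      using n c_pos by (intro divide_left_mono) auto
    moreover have "expectation (\<lambda>\<omega>. \<psi> (iter n \<omega>) (J (Suc n) \<omega>)) \<le> b / sqrt (real n) + (e n - e (Suc n)) +
        (2 * R * L * c * B + 12 * R\<^sup>2 * Qmax * L * D / \<Delta> + m\<^sub>0 * C\<^sup>2 * \<beta> (Suc n)) / sqrt (real n)"
      using expectation_\<psi>[of n] b(2)[OF n] expectation_drift[OF n] unfolding e_def m by linarith
    ultimately show ?thesis
      unfolding a_def add_divide_distrib by linarith
  qed
  have d: "0 \<le> d n" "d n \<le> D\<^sup>2" for n
  proof -
    show "0 \<le> d n" unfolding d_def by (rule Bochner_Integration.integral_nonneg) simp
    have "d n \<le> expectation (\<lambda>\<omega>. D\<^sup>2)"
      unfolding d_def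
      by (intro integral_mono integrable_iter[of "\<lambda>x. (norm (x - xstar))\<^sup>2"] integrable_const power_mono)
        (auto intro: diam iter_in xstar)
    then show "d n \<le> D\<^sup>2" by (simp add: prob_space)
  qed
  have e: "\<bar>e n\<bar> \<le> R * (2 * L * D)" for n
  proof -
    have "\<bar>e n\<bar> \<le> expectation (\<lambda>\<omega>. \<bar>\<eta> n (iter n \<omega>) (J n \<omega>)\<bar>)"
      unfolding e_def by (rule integral_abs_bound)
    also have "\<dots> \<le> expectation (\<lambda>\<omega>. R * (2 * L * D))"
      by (intro integral_mono integrable_iter_index integrable_abs integrable_const \<eta>_bound iter_in J_in)
    finally show ?thesis by (simp add: prob_space)
  qed
  have a: "0 \<le> a"
    using b(1) c_pos B_nonneg D_nonneg L_nonneg R_ge_1 Qmax_nonneg \<Delta>_pos by (simp add: a_def)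
  let ?K = "D\<^sup>2 / c + 4 * (R * (2 * L * D)) + 2 * a"
  have avg: "expectation (\<lambda>\<omega>. F (xbar n \<omega>)) - F xstar \<le> (?K + 2 * (m\<^sub>0 * C\<^sup>2) * \<beta> (Suc n)) / sqrt (real n)"
    if n: "1 \<le> n" for n
  proof -
    have S: "0 < (\<Sum>k=1..n. real k)" using n by (intro sum_pos) auto
    have "expectation (\<lambda>\<omega>. F (xbar n \<omega>)) \<le>
        expectation (\<lambda>\<omega>. (\<Sum>k=1..n. real k * F (iter k \<omega>)) / (\<Sum>k=1..n. real k))"
      by (intro integral_mono integrable_F_xbar F_linear_average_le[OF n] iter_in
          Bochner_Integration.integrable_divide Bochner_Integration.integrable_sum integrable_mult_right integrable_iter)
    also have "\<dots> = (\<Sum>k=1..n. real k * expectation (\<lambda>\<omega>. F (iter k \<omega>))) / (\<Sum>k=1..n. real k)"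
      by (simp add: integrable_iter)
    also have "\<dots> = (\<Sum>k=1..n. real k * u k) / (\<Sum>k=1..n. real k) + F xstar"
      using S by (simp add: u_def right_diff_distrib sum_subtractf diff_divide_distrib flip: sum_distrib_right)
    finally have "expectation (\<lambda>\<omega>. F (xbar n \<omega>)) - F xstar \<le> (\<Sum>k=1..n. real k * u k) / (\<Sum>k=1..n. real k)"
      by simp
    also have "\<dots> \<le> (?K + 2 * (m\<^sub>0 * C\<^sup>2) * \<beta> (Suc n)) / sqrt (real n)"
      using \<beta>_mono m0 a c_pos n
      by (intro sum_weighted_errors_le[where d = d and e = e and \<beta> = "\<lambda>k. \<beta> (Suc k)"] u d e)
        (auto simp: \<beta>_pos less_imp_le mono_def)
    finally show ?thesis .
  qed
  have K: "2 * m\<^sub>0 / \<Delta> + 1 = 48 * \<kappa>\<^sup>2 * L\<^sup>2 * D * c * B / \<Delta> + 1" by (simp add: m\<^sub>0_def)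
  have N: "1 \<le> card I" using card_I by simp
  show ?thesis
    unfolding INF_F
    using log_rate_absorbs_constant[OF C_ge_1 N \<Delta>_pos m0, of ?K] eventually_ge_at_top[of 1]
  proof eventually_elim
    case (elim n)
    have "\<beta> (Suc n) = ln ((real n + 3) * (real (card I))\<^sup>2) / (2 * \<Delta>)"
      by (simp add: \<beta>_def add.commute)
    with avg[OF elim(2)] elim(1) show ?case unfolding K by simp
  qed
qed

end

theorem proposition2:
  fixes X S :: "(real ^ 'x) set"
    and f :: "real ^ 'x \<Rightarrow> real"
    and g :: "real ^ 'x \<Rightarrow> real ^ 'x"
    and G :: "real ^ 'y ^ 'm" and E :: "real ^ 'x ^ 'm" and U :: "real ^ 'u ^ 'm"
    and b :: "real ^ 'y" and h :: "real ^ 'm"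
    and D Lf c \<Delta> \<kappa> :: real
  assumes "compact X" and "convex X" and "\<forall>x\<in>X. \<forall>x'\<in>X. norm1 (x - x') \<le> D"
    and "open S" and "X \<subseteq> S" and "convex_on S f" and "Lf-lipschitz_on S f"
    and "\<forall>x\<in>X. g x \<in> subdifferential S f x" and "bounded (g ` X)"
    and "g \<in> borel_measurable (restrict_space borel X)"
    and "c > 0" and "\<Delta> > 0"
  shows "\<exists>K. \<forall>(I :: 'i set) (\<xi> :: 'i \<Rightarrow> real ^ 'u) (\<pi>star :: real ^ 'x \<Rightarrow> 'i \<Rightarrow> real ^ 'm)
           (rule :: acceptance_rule) (q :: 'i \<Rightarrow> 'i \<Rightarrow> real) (N :: ('i \<Rightarrow> real) \<Rightarrow> real) (C :: real)
           (x0 :: real ^ 'x) (M :: 'w measure) (J :: nat \<Rightarrow> 'w \<Rightarrow> 'i).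
    (let Q = (\<lambda>x i. recourse_value G E U b h x (\<xi> i));
         Z = (\<lambda>x i. g x - transpose E *v \<pi>star x i);
         w = (\<lambda>n. 2 * \<Delta> / ln ((real n + 2) * (real (card I))\<^sup>2));
         \<alpha> = (\<lambda>n. c / sqrt (real n));
         xpath = iterate X \<alpha> Z x0;
         x = (\<lambda>n \<omega>. xpath (\<lambda>k. J k \<omega>) n);
         F = (\<lambda>x. f x + (MAX i\<in>I. Q x i));
         Fstar = (INF x\<in>X. F x);
         xbar = (\<lambda>n \<omega>. linear_average (\<lambda>k. x k \<omega>) n)
     in finite I \<longrightarrow> I \<noteq> {} \<longrightarrow>
        (\<forall>x\<in>X. \<forall>i\<in>I. recourse_finite G E U b h x (\<xi> i)) \<longrightarrow>
        (\<forall>x\<in>X. \<forall>i\<in>I. is_arg_min (\<lambda>\<pi>. norm1 (transpose E *v \<pi>))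
                          (\<lambda>\<pi>. \<pi> \<in> dual_solutions G E U b h x (\<xi> i)) (\<pi>star x i)) \<longrightarrow>
        (\<forall>i\<in>I. \<forall>j\<in>I. q j i > 0) \<longrightarrow> (\<forall>i\<in>I. (\<Sum>j\<in>I. q j i) = 1) \<longrightarrow>
        norm_on I N \<longrightarrow> max_norm_equivalent \<kappa> I N \<longrightarrow> C > 0 \<longrightarrow>
        (\<forall>n. \<forall>x\<in>X. operator_norm I N (fundamental_matrix rule I q (w n) (Q x)) \<le> C) \<longrightarrow>
        x0 \<in> X \<longrightarrow>
        adaptive_chain M I J (\<lambda>n js. transition rule I q (w n) (Q (xpath js n))) \<longrightarrow>
        (\<forall>\<^sub>F n in sequentially. AE \<omega> in M. ereal \<Delta> \<le> gap I (Q (x n \<omega>))) \<longrightarrow>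
        (\<forall>n\<ge>1. integrable M (\<lambda>\<omega>. F (xbar n \<omega>)) \<and> 0 \<le> (\<integral>\<omega>. F (xbar n \<omega>) \<partial>M) - Fstar) \<and>
        (\<forall>\<^sub>F n in sequentially. (\<integral>\<omega>. F (xbar n \<omega>) \<partial>M) - Fstar
            \<le> K * ((1 + C\<^sup>2 * ln (real n * real (card I))) / sqrt (real n))))"
proof -
  obtain BE where BE: "0 \<le> BE"
    "\<And>(U :: real ^ 'u ^ 'm) h x \<xi> \<pi>. is_arg_min (\<lambda>\<pi>. norm1 (transpose E *v \<pi>))
        (\<lambda>\<pi>. \<pi> \<in> dual_solutions G E U b h x \<xi>) \<pi> \<Longrightarrow> norm (transpose E *v \<pi>) \<le> BE"
    using optimal_dual_norm1_bound[where G = G and E = E and b = b and ?'u = 'u] by blast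
  obtain Bg where Bg: "\<And>x. x \<in> X \<Longrightarrow> norm (g x) \<le> Bg"
    using \<open>bounded (g ` X)\<close> unfolding bounded_iff by blast
  define B where "B = Bg + BE"
  show ?thesis
  \<comment> \<open>The witness contains only data fixed before the scenario set; \<open>BE\<close>
    acts as the Lipschitz constant of the recourse values.\<close>
  proof (intro exI[of _ "48 * \<kappa>\<^sup>2 * BE\<^sup>2 * D * c * B / \<Delta> + 1"] allI, unfold Let_def, intro impI)
    fix I :: "'i set" and \<xi> :: "'i \<Rightarrow> real ^ 'u" and \<pi>star :: "real ^ 'x \<Rightarrow> 'i \<Rightarrow> real ^ 'm"
      and rule :: acceptance_rule and q :: "'i \<Rightarrow> 'i \<Rightarrow> real" and N :: "('i \<Rightarrow> real) \<Rightarrow> real"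
      and C :: real and x0 :: "real ^ 'x" and M :: "'w measure" and J :: "nat \<Rightarrow> 'w \<Rightarrow> 'i"
    let ?Q = "\<lambda>x i. recourse_value G E U b h x (\<xi> i)" and ?Z = "\<lambda>x i. g x - transpose E *v \<pi>star x i"
    let ?w = "\<lambda>n. 2 * \<Delta> / ln ((real n + 2) * (real (card I))\<^sup>2)"
    let ?x = "iterate X (\<lambda>n. c / sqrt (real n)) ?Z x0"
    assume I: "finite I" "I \<noteq> {}"
      and fin: "\<forall>x\<in>X. \<forall>i\<in>I. recourse_finite G E U b h x (\<xi> i)"
      and \<pi>star: "\<forall>x\<in>X. \<forall>i\<in>I. is_arg_min (\<lambda>\<pi>. norm1 (transpose E *v \<pi>))
          (\<lambda>\<pi>. \<pi> \<in> dual_solutions G E U b h x (\<xi> i)) (\<pi>star x i)"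
      and q: "\<forall>i\<in>I. \<forall>j\<in>I. 0 < q j i" "\<forall>i\<in>I. (\<Sum>j\<in>I. q j i) = 1"
      and N: "norm_on I N" "max_norm_equivalent \<kappa> I N" and C: "0 < C"
      and fund: "\<forall>n. \<forall>x\<in>X. operator_norm I N (fundamental_matrix rule I q (?w n) (?Q x)) \<le> C"
      and x0: "x0 \<in> X"
      and chain: "adaptive_chain M I J (\<lambda>n js. transition rule I q (?w n) (?Q (?x js n)))"
      and gap: "\<forall>\<^sub>F n in sequentially. AE \<omega> in M. ereal \<Delta> \<le> gap I (?Q (?x (\<lambda>k. J k \<omega>) n))"
    interpret prob_space M
      using chain by (simp add: adaptive_chain_def)
    have sol: "\<pi>star x i \<in> dual_solutions G E U b h x (\<xi> i)" if "x \<in> X" "i \<in> I" for x i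
      using \<pi>star that by (simp add: is_arg_min_def)
    have E\<pi>: "norm (transpose E *v \<pi>star x i) \<le> BE" if "x \<in> X" "i \<in> I" for x i
      using BE(2) \<pi>star that by blast
    have Q_sub: "?Q x i - (transpose E *v \<pi>star x i) \<bullet> (y - x) \<le> ?Q y i" if "x \<in> X" "y \<in> X" "i \<in> I" for x y i
      using fin that sol by (intro recourse_value_subgradient) auto
    interpret soft_separation I q rule M J \<Delta> ?Q X c ?Z x0 f N \<kappa> C BE B D
    proof unfold_locales
      show "norm (x - y) \<le> D" if "x \<in> X" "y \<in> X" for x y
        using norm_le_l1_cart[of "x - y"] assms(3) that by (fastforce simp: norm1_def)
      show "f x + ?Q x i + ?Z x i \<bullet> (y - x) \<le> f y + ?Q y i" if "x \<in> X" "y \<in> X" "i \<in> I" for x y i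
      proof -
        have "f x + g x \<bullet> (y - x) \<le> f y"
          using assms(5,8) that by (auto simp: subdifferential_def)
        with Q_sub[OF that] show ?thesis by (simp add: inner_diff_left del: transpose_matrix_vector)
      qed
      show "\<bar>?Q x i - ?Q y i\<bar> \<le> BE * norm (x - y)" if "x \<in> X" "y \<in> X" "i \<in> I" for x y i
      proof -
        have *: "?Q x i - ?Q y i \<le> BE * norm (x - y)" if "x \<in> X" "y \<in> X" for x y
        proof -
          have "?Q x i - ?Q y i \<le> (transpose E *v \<pi>star x i) \<bullet> (y - x)"
            using Q_sub[OF that \<open>i \<in> I\<close>] by linarith
          also have "\<dots> \<le> norm (transpose E *v \<pi>star x i) * norm (y - x)"
            by (rule norm_cauchy_schwarz)
          also have "\<dots> \<le> BE * norm (x - y)"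
            using E\<pi>[OF that(1) \<open>i \<in> I\<close>] by (simp add: norm_minus_commute mult_right_mono del: transpose_matrix_vector)
          finally show ?thesis .
        qed
        from *[OF that(1,2)] *[OF that(2,1)] show ?thesis by (simp add: norm_minus_commute abs_le_iff)
      qed
      show "norm (?Z x i) \<le> B" if "x \<in> X" "i \<in> I" for x i
        using norm_triangle_ineq4[of "g x" "transpose E *v \<pi>star x i"] Bg[OF that(1)] E\<pi>[OF that]
        unfolding B_def by linarith
    qed (use assms I q N C fund x0 chain gap BE(1) in auto)
    let ?F = "\<lambda>x. f x + (MAX i\<in>I. ?Q x i)"
    have F: "F = ?F" by (simp add: fun_eq_iff F_def)
    show "(\<forall>n\<ge>1. integrable M (\<lambda>\<omega>. ?F (linear_average (\<lambda>k. ?x (\<lambda>k. J k \<omega>) k) n)) \<and>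
          0 \<le> expectation (\<lambda>\<omega>. ?F (linear_average (\<lambda>k. ?x (\<lambda>k. J k \<omega>) k) n)) - (INF x\<in>X. ?F x)) \<and>
        (\<forall>\<^sub>F n in sequentially.
          expectation (\<lambda>\<omega>. ?F (linear_average (\<lambda>k. ?x (\<lambda>k. J k \<omega>) k) n)) - (INF x\<in>X. ?F x)
          \<le> (48 * \<kappa>\<^sup>2 * BE\<^sup>2 * D * c * B / \<Delta> + 1) * ((1 + C\<^sup>2 * ln (real n * real (card I))) / sqrt (real n)))"
      using integrable_F_xbar expectation_gap_nonneg convergence_rate unfolding F by blast
  qed
qed

end
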